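(* Let $Q$ be a smooth manifold, $h\in C^\infty(T^*Q\times\mathbb R\times\mathbb R)$, and $\eta^E$ the associated 1-form on the extended contact phase space $T^*Q\times\mathbb R\times\mathbb R$. Then the set of generalized Noether symmetries, i.e. of vector fields $Y$ on $T^*Q\times\mathbb R\times\mathbb R$ such that $\mathfrak L_Y\eta^E=\lambda\,\eta^E$ for some $\lambda\in C^\infty(T^*Q\times\mathbb R\times\mathbb R)$, forms a Lie algebra with the Lie bracket of vector fields.
   Context: Everything is smooth; $\mathfrak L$ denotes the Lie derivative. Let $\alpha$ be the Liouville 1-form on $T^*Q$ (locally $\alpha=p_a dq^a$). The contact phase space is $T^*Q\times\mathbb R$ with contact form $\eta=dS-\alpha$ (pullback understood), $S$ the coordinate on $\mathbb R$. The extended contact phase space is $T^*Q\times\mathbb R\times\mathbb R$, with $t$ the coordinate on the last factor, endowed with the 1-form $\eta^E=\eta+h\,dt$ (pullback of $\eta$ understood), where $h$ is a given smooth function of $(q,p,S,t)$. *)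

theory Defs
  imports "HOL-Analysis.Analysis"
begin

subsection \<open>Smooth maps between open subsets of normed spaces\<close>

primrec times_differentiable_on ::
  "nat \<Rightarrow> 'e::real_normed_vector set \<Rightarrow> ('e \<Rightarrow> 'f::real_normed_vector) \<Rightarrow> bool" where
  "times_differentiable_on 0 S f \<longleftrightarrow> continuous_on S f"
| "times_differentiable_on (Suc n) S f \<longleftrightarrow>
     (\<forall>x\<in>S. f differentiable (at x)) \<and>
     (\<forall>v. times_differentiable_on n S (\<lambda>x. frechet_derivative f (at x) v))"

text \<open>Only used for open \<open>S\<close> in finite-dimensional spaces, where it means \<open>C\<^sup>\<infinity>\<close>.\<close>

definition smooth_on ::
  "'e::real_normed_vector set \<Rightarrow> ('e \<Rightarrow> 'f::real_normed_vector) \<Rightarrow> bool" where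
  "smooth_on S f \<longleftrightarrow> (\<forall>n. times_differentiable_on n S f)"

subsection \<open>Smooth manifolds\<close>

text \<open>A manifold is given by an atlas on a set of points (the union of the chart domains),
  which carries the topology induced by the charts. The model space \<open>'e\<close> is only required to be
  a finite-dimensional inner product space, rather than of class \<open>euclidean_space\<close>,
  so that dimension 0 is not excluded.\<close>

type_synonym ('a, 'e) atlas = "('a set \<times> ('a \<Rightarrow> 'e)) set"

definition atlas_space :: "('a, 'e) atlas \<Rightarrow> 'a set" where
  "atlas_space A = (\<Union>(D, \<phi>)\<in>A. D)"

definition atlas_open :: "('a, 'e::real_normed_vector) atlas \<Rightarrow> 'a set \<Rightarrow> bool" where
  "atlas_open A U \<longleftrightarrow> U \<subseteq> atlas_space A \<and> (\<forall>(D, \<phi>)\<in>A. open (\<phi> ` (U \<inter> D)))"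

definition atlas_topology :: "('a, 'e::real_normed_vector) atlas \<Rightarrow> 'a topology" where
  "atlas_topology A = topology (atlas_open A)"

definition smooth_atlas :: "('a, 'e::real_normed_vector) atlas \<Rightarrow> bool" where
  "smooth_atlas A \<longleftrightarrow>
     (\<forall>(D, \<phi>)\<in>A. inj_on \<phi> D \<and> open (\<phi> ` D)) \<and>
     (\<forall>(D, \<phi>)\<in>A. \<forall>(E, \<psi>)\<in>A.
        open (\<phi> ` (D \<inter> E)) \<and> smooth_on (\<phi> ` (D \<inter> E)) (\<psi> \<circ> inv_into D \<phi>))"

definition smooth_manifold :: "('a, 'e::real_inner) atlas \<Rightarrow> bool" where
  "smooth_manifold A \<longleftrightarrow>
     (\<exists>B::'e set. finite B \<and> span B = UNIV) \<and>
     smooth_atlas A \<and>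
     Hausdorff_space (atlas_topology A) \<and>
     (\<exists>\<B>. countable \<B> \<and> (\<forall>V\<in>\<B>. openin (atlas_topology A) V) \<and>
          (\<forall>U p. openin (atlas_topology A) U \<and> p \<in> U \<longrightarrow> (\<exists>V\<in>\<B>. p \<in> V \<and> V \<subseteq> U)))"

lemma openin_atlas_topology:
  assumes "smooth_atlas A"
  shows "openin (atlas_topology A) U \<longleftrightarrow> atlas_open A U"
proof -
  have inter: "atlas_open A (S \<inter> T)" if S: "atlas_open A S" and T: "atlas_open A T" for S T
    unfolding atlas_open_def
  proof (intro conjI ballI)
    show "S \<inter> T \<subseteq> atlas_space A"
      using S by (auto simp: atlas_open_def)
    fix c assume c: "c \<in> A"
    obtain D \<phi> where [simp]: "c = (D, \<phi>)"
      by (cases c)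
    have "inj_on \<phi> D"
      using assms c by (auto simp: smooth_atlas_def)
    then have "\<phi> ` (S \<inter> T \<inter> D) = \<phi> ` (S \<inter> D) \<inter> \<phi> ` (T \<inter> D)"
      by (auto simp: inj_on_def)
    then show "case c of (D, \<phi>) \<Rightarrow> open (\<phi> ` (S \<inter> T \<inter> D))"
      using S T c by (auto simp: atlas_open_def)
  qed
  have union: "atlas_open A (\<Union>\<K>)" if K: "\<forall>K\<in>\<K>. atlas_open A K" for \<K>
    unfolding atlas_open_def
  proof (intro conjI ballI)
    show "\<Union>\<K> \<subseteq> atlas_space A"
      using K by (auto simp: atlas_open_def)
    fix c assume c: "c \<in> A"
    obtain D \<phi> where [simp]: "c = (D, \<phi>)"
      by (cases c)
    have "\<phi> ` (\<Union>\<K> \<inter> D) = (\<Union>K\<in>\<K>. \<phi> ` (K \<inter> D))"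
      by auto
    then show "case c of (D, \<phi>) \<Rightarrow> open (\<phi> ` (\<Union>\<K> \<inter> D))"
      using K c by (auto simp: atlas_open_def intro!: open_UN)
  qed
  have "istopology (atlas_open A)"
    using inter union unfolding istopology_def by blast
  then show ?thesis
    by (simp add: atlas_topology_def)
qed

definition real_atlas :: "(real, real) atlas" where
  "real_atlas = {(UNIV, id)}"

definition prod_atlas :: "('a, 'e) atlas \<Rightarrow> ('b, 'f) atlas \<Rightarrow> ('a \<times> 'b, 'e \<times> 'f) atlas" where
  "prod_atlas A B = {(D \<times> E, map_prod \<phi> \<psi>) | D \<phi> E \<psi>. (D, \<phi>) \<in> A \<and> (E, \<psi>) \<in> B}"

subsection \<open>Smooth functions, tangent vectors, vector fields\<close>

text \<open>For open \<open>U\<close>; the values of \<open>f\<close> outside \<open>U\<close> are irrelevant.\<close>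

definition smooth_fun_on :: "('a, 'e::real_normed_vector) atlas \<Rightarrow> 'a set \<Rightarrow> ('a \<Rightarrow> real) \<Rightarrow> bool" where
  "smooth_fun_on A U f \<longleftrightarrow> (\<forall>(D, \<phi>)\<in>A. smooth_on (\<phi> ` (U \<inter> D)) (f \<circ> inv_into D \<phi>))"

definition smooth_at :: "('a, 'e::real_normed_vector) atlas \<Rightarrow> 'a \<Rightarrow> ('a \<Rightarrow> real) \<Rightarrow> bool" where
  "smooth_at A p f \<longleftrightarrow> (\<exists>U. atlas_open A U \<and> p \<in> U \<and> smooth_fun_on A U f)"

definition smooth_curve :: "('a, 'e::real_normed_vector) atlas \<Rightarrow> real set \<Rightarrow> (real \<Rightarrow> 'a) \<Rightarrow> bool" where
  "smooth_curve A I \<gamma> \<longleftrightarrow>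
     \<gamma> ` I \<subseteq> atlas_space A \<and>
     (\<forall>(D, \<phi>)\<in>A. open {s \<in> I. \<gamma> s \<in> D} \<and> smooth_on {s \<in> I. \<gamma> s \<in> D} (\<phi> \<circ> \<gamma>))"

text \<open>A tangent vector at \<open>p\<close> is the velocity of a smooth curve through \<open>p\<close>, acting on the functions
  that are smooth near \<open>p\<close> by \<open>f \<mapsto> (f \<circ> \<gamma>)'(0)\<close>. On all other functions it takes the
  dummy value 0, so that equality of tangent vectors is equality of HOL functions; vector fields
  and covectors are extended by 0 in the same way.\<close>

type_synonym 'a tangent = "('a \<Rightarrow> real) \<Rightarrow> real"

definition velocity :: "('a, 'e::real_normed_vector) atlas \<Rightarrow> (real \<Rightarrow> 'a) \<Rightarrow> 'a tangent" where
  "velocity A \<gamma> = (\<lambda>f. if smooth_at A (\<gamma> 0) f then deriv (f \<circ> \<gamma>) 0 else 0)"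

definition tangent_space :: "('a, 'e::real_normed_vector) atlas \<Rightarrow> 'a \<Rightarrow> 'a tangent set" where
  "tangent_space A p =
     {velocity A \<gamma> | \<gamma> \<epsilon>. 0 < \<epsilon> \<and> smooth_curve A {-\<epsilon><..<\<epsilon>} \<gamma> \<and> \<gamma> 0 = p}"

definition vector_fields :: "('a, 'e::real_normed_vector) atlas \<Rightarrow> ('a \<Rightarrow> 'a tangent) set" where
  "vector_fields A = {X.
     (\<forall>p\<in>atlas_space A. X p \<in> tangent_space A p) \<and>
     (\<forall>p. p \<notin> atlas_space A \<longrightarrow> X p = (\<lambda>f. 0)) \<and>
     (\<forall>U f. atlas_open A U \<and> smooth_fun_on A U f \<longrightarrow> smooth_fun_on A U (\<lambda>p. X p f))}"

definition vf_zero :: "'a \<Rightarrow> 'a tangent" where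
  "vf_zero = (\<lambda>p f. 0)"

definition vf_add :: "('a \<Rightarrow> 'a tangent) \<Rightarrow> ('a \<Rightarrow> 'a tangent) \<Rightarrow> 'a \<Rightarrow> 'a tangent" where
  "vf_add X Y = (\<lambda>p f. X p f + Y p f)"

definition vf_scale :: "real \<Rightarrow> ('a \<Rightarrow> 'a tangent) \<Rightarrow> 'a \<Rightarrow> 'a tangent" where
  "vf_scale c X = (\<lambda>p f. c * X p f)"

definition lie_bracket ::
  "('a, 'e::real_normed_vector) atlas \<Rightarrow> ('a \<Rightarrow> 'a tangent) \<Rightarrow> ('a \<Rightarrow> 'a tangent) \<Rightarrow> 'a \<Rightarrow> 'a tangent" where
  "lie_bracket A X Y = (\<lambda>p f.
     if smooth_at A p f then X p (\<lambda>x. Y x f) - Y p (\<lambda>x. X x f) else 0)"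

subsection \<open>Differential 1-forms\<close>

type_synonym 'a one_form = "'a \<Rightarrow> 'a tangent \<Rightarrow> real"

definition differential :: "('a \<Rightarrow> real) \<Rightarrow> 'a one_form" where
  "differential f = (\<lambda>p v. v f)"

definition pushforward ::
  "('b, 'f::real_normed_vector) atlas \<Rightarrow> ('a \<Rightarrow> 'b) \<Rightarrow> 'a \<Rightarrow> 'a tangent \<Rightarrow> 'b tangent" where
  "pushforward B F p v = (\<lambda>f. if smooth_at B (F p) f then v (f \<circ> F) else 0)"

definition pullback ::
  "('b, 'f::real_normed_vector) atlas \<Rightarrow> ('a \<Rightarrow> 'b) \<Rightarrow> 'b one_form \<Rightarrow> 'a one_form" where
  "pullback B F \<omega> = (\<lambda>p v. \<omega> (F p) (pushforward B F p v))"

text \<open>The Lie derivative of a 1-form along \<open>Y\<close> is the tensor derivation extending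
  \<open>f \<mapsto> Y f\<close> on functions and \<open>X \<mapsto> [Y, X]\<close> on vector fields, i.e.
  \<open>Y (\<omega>(X)) = (L\<^sub>Y \<omega>)(X) + \<omega>([Y, X])\<close>. Here \<open>L\<^sub>Y \<omega>\<close> is regarded as the
  \<open>C\<^sup>\<infinity>\<close>-linear map sending a vector field \<open>X\<close> to the function \<open>(L\<^sub>Y \<omega>)(X)\<close>.\<close>

definition lie_derivative ::
  "('a, 'e::real_normed_vector) atlas \<Rightarrow> ('a \<Rightarrow> 'a tangent) \<Rightarrow> 'a one_form \<Rightarrow>
     ('a \<Rightarrow> 'a tangent) \<Rightarrow> 'a \<Rightarrow> real" where
  "lie_derivative A Y \<omega> X = (\<lambda>p. Y p (\<lambda>x. \<omega> x (X x)) - \<omega> p (lie_bracket A Y X p))"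

subsection \<open>The cotangent bundle and its Liouville form\<close>

type_synonym 'a covector = "'a tangent \<Rightarrow> real"

definition cotangent_space :: "('a, 'e::real_normed_vector) atlas \<Rightarrow> 'a \<Rightarrow> 'a covector set" where
  "cotangent_space A q = {\<xi>.
     (\<forall>v\<in>tangent_space A q. \<forall>w\<in>tangent_space A q. \<xi> (\<lambda>f. v f + w f) = \<xi> v + \<xi> w) \<and>
     (\<forall>c. \<forall>v\<in>tangent_space A q. \<xi> (\<lambda>f. c * v f) = c * \<xi> v) \<and>
     (\<forall>v. v \<notin> tangent_space A q \<longrightarrow> \<xi> v = 0)}"

text \<open>The coordinate vector at \<open>q\<close> in the direction \<open>u\<close> of the model space; for a basis vector \<open>u\<close>
  this is the usual \<open>\<partial>/\<partial>q\<^sup>a\<close>.\<close>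

definition coordinate_vector ::
  "('a, 'e::real_normed_vector) atlas \<Rightarrow> 'a set \<Rightarrow> ('a \<Rightarrow> 'e) \<Rightarrow> 'a \<Rightarrow> 'e \<Rightarrow> 'a tangent" where
  "coordinate_vector A D \<phi> q u = velocity A (\<lambda>s. inv_into D \<phi> (\<phi> q + s *\<^sub>R u))"

text \<open>The components \<open>p\<^sub>a = \<xi>(\<partial>/\<partial>q\<^sup>a)\<close>, collected (with respect to any orthonormal basis)
  into a vector of the model space.\<close>

definition momentum ::
  "('a, 'e::real_inner) atlas \<Rightarrow> 'a set \<Rightarrow> ('a \<Rightarrow> 'e) \<Rightarrow> 'a \<Rightarrow> 'a covector \<Rightarrow> 'e" where
  "momentum A D \<phi> q \<xi> = (THE p. \<forall>u. p \<bullet> u = \<xi> (coordinate_vector A D \<phi> q u))"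

definition cotangent_bundle ::
  "('a, 'e::real_inner) atlas \<Rightarrow> ('a \<times> 'a covector, 'e \<times> 'e) atlas" where
  "cotangent_bundle A =
     {(Sigma D (cotangent_space A), \<lambda>(q, \<xi>). (\<phi> q, momentum A D \<phi> q \<xi>)) | D \<phi>. (D, \<phi>) \<in> A}"

text \<open>The tautological form \<open>\<alpha>\<^bsub>(q, \<xi>)\<^esub>(v) = \<xi>(d\<pi>(v))\<close>, which is \<open>p\<^sub>a dq\<^sup>a\<close> in
  the charts above.\<close>

definition liouville_form :: "('a, 'e::real_inner) atlas \<Rightarrow> ('a \<times> 'a covector) one_form" where
  "liouville_form A = (\<lambda>x v. snd x (pushforward A fst x v))"

subsection \<open>Contact phase space and extended contact phase space\<close>

definition contact_phase_space ::
  "('q, 'e::real_inner) atlas \<Rightarrow> (('q \<times> 'q covector) \<times> real, ('e \<times> 'e) \<times> real) atlas" where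
  "contact_phase_space Q = prod_atlas (cotangent_bundle Q) real_atlas"

definition contact_form :: "('q, 'e::real_inner) atlas \<Rightarrow> (('q \<times> 'q covector) \<times> real) one_form" where
  "contact_form Q = (\<lambda>m v.
     differential snd m v - pullback (cotangent_bundle Q) fst (liouville_form Q) m v)"

definition extended_phase_space ::
  "('q, 'e::real_inner) atlas \<Rightarrow>
     ((('q \<times> 'q covector) \<times> real) \<times> real, (('e \<times> 'e) \<times> real) \<times> real) atlas" where
  "extended_phase_space Q = prod_atlas (contact_phase_space Q) real_atlas"

definition extended_form ::
  "('q, 'e::real_inner) atlas \<Rightarrow> ((('q \<times> 'q covector) \<times> real) \<times> real \<Rightarrow> real) \<Rightarrow>
     ((('q \<times> 'q covector) \<times> real) \<times> real) one_form" where
  "extended_form Q h = (\<lambda>m v.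
     pullback (contact_phase_space Q) fst (contact_form Q) m v + h m * differential snd m v)"

definition generalized_noether_symmetries ::
  "('q, 'e::real_inner) atlas \<Rightarrow> ((('q \<times> 'q covector) \<times> real) \<times> real \<Rightarrow> real) \<Rightarrow>
     ((('q \<times> 'q covector) \<times> real) \<times> real \<Rightarrow>
      ((('q \<times> 'q covector) \<times> real) \<times> real) tangent) set" where
  "generalized_noether_symmetries Q h =
     (let M = extended_phase_space Q; \<eta> = extended_form Q h in
      {Y \<in> vector_fields M. \<exists>\<mu>. smooth_fun_on M (atlas_space M) \<mu> \<and>
         (\<forall>X\<in>vector_fields M. \<forall>m\<in>atlas_space M.
            lie_derivative M Y \<eta> X m = \<mu> m * \<eta> m (X m))})"

subsection \<open>Real Lie algebras\<close>

locale real_lie_algebra =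
  fixes V :: "'v set"
    and add :: "'v \<Rightarrow> 'v \<Rightarrow> 'v"
    and zero :: 'v
    and scale :: "real \<Rightarrow> 'v \<Rightarrow> 'v"
    and bracket :: "'v \<Rightarrow> 'v \<Rightarrow> 'v"
  assumes zero_closed: "zero \<in> V"
    and add_closed: "\<lbrakk>x \<in> V; y \<in> V\<rbrakk> \<Longrightarrow> add x y \<in> V"
    and scale_closed: "x \<in> V \<Longrightarrow> scale c x \<in> V"
    and bracket_closed: "\<lbrakk>x \<in> V; y \<in> V\<rbrakk> \<Longrightarrow> bracket x y \<in> V"
    and add_assoc: "\<lbrakk>x \<in> V; y \<in> V; z \<in> V\<rbrakk> \<Longrightarrow> add (add x y) z = add x (add y z)"
    and add_commute: "\<lbrakk>x \<in> V; y \<in> V\<rbrakk> \<Longrightarrow> add x y = add y x"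
    and add_zero: "x \<in> V \<Longrightarrow> add zero x = x"
    and add_inverse: "x \<in> V \<Longrightarrow> \<exists>y\<in>V. add x y = zero"
    and scale_one: "x \<in> V \<Longrightarrow> scale 1 x = x"
    and scale_scale: "x \<in> V \<Longrightarrow> scale a (scale b x) = scale (a * b) x"
    and scale_add_left: "x \<in> V \<Longrightarrow> scale (a + b) x = add (scale a x) (scale b x)"
    and scale_add_right: "\<lbrakk>x \<in> V; y \<in> V\<rbrakk> \<Longrightarrow> scale a (add x y) = add (scale a x) (scale a y)"
    and bracket_add_left:
      "\<lbrakk>x \<in> V; y \<in> V; z \<in> V\<rbrakk> \<Longrightarrow> bracket (add x y) z = add (bracket x z) (bracket y z)"
    and bracket_add_right:
      "\<lbrakk>x \<in> V; y \<in> V; z \<in> V\<rbrakk> \<Longrightarrow> bracket x (add y z) = add (bracket x y) (bracket x z)"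
    and bracket_scale_left: "\<lbrakk>x \<in> V; y \<in> V\<rbrakk> \<Longrightarrow> bracket (scale a x) y = scale a (bracket x y)"
    and bracket_scale_right: "\<lbrakk>x \<in> V; y \<in> V\<rbrakk> \<Longrightarrow> bracket x (scale a y) = scale a (bracket x y)"
    and bracket_self: "x \<in> V \<Longrightarrow> bracket x x = zero"
    and jacobi:
      "\<lbrakk>x \<in> V; y \<in> V; z \<in> V\<rbrakk> \<Longrightarrow>
         add (bracket x (bracket y z)) (add (bracket y (bracket z x)) (bracket z (bracket x y))) = zero"

end

theory Submission
  imports Defs
begin

text \<open>
  If \<open>L\<^sub>Y \<eta> = \<mu> \<eta>\<close> and \<open>L\<^sub>Z \<eta> = \<nu> \<eta>\<close>, then \<open>L\<^bsub>[Y, Z]\<^esub> \<eta> = [L\<^sub>Y, L\<^sub>Z] \<eta> = (Y \<nu> - Z \<mu>) \<eta>\<close>; nothing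
  but linearity and smoothness of the form \<open>\<eta>\<close> enters. What has to be checked is that the bracket
  of vector fields is again a vector field, which comes down to the symmetry of second derivatives
  in a chart, that the charts of the extended phase space are smoothly compatible, and that
  \<open>\<eta>(X) = X(S) - p\<^sub>a X(q\<^sup>a) + h X(t)\<close> is smooth for every vector field \<open>X\<close>.
\<close>

subsection \<open>Calculus of smooth maps\<close>

text \<open>Two features of the setting shape the argument. Curves cannot be added, so the linear
  structure of a tangent space is not visible from velocities; it comes from a chart, where a
  velocity depends only on one direction of the model space and straight lines realise every
  direction. The Lie derivative is given only through its values on vector fields, so the symmetry
  condition is read as a rule for differentiating a pairing, Y(\<omega>(X)) = \<mu> \<omega>(X) +
  \<omega>([Y, X]). This rule can be iterated; in Y Z - Z Y the mixed terms cancel and the double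
  brackets combine by the Jacobi identity. Since tangent vectors are total functions with dummy
  value 0, evaluations carry smoothness side conditions, and an equality of tangent vectors has to
  hold at the dummy values too. The projections T*Q x R x R -> T*Q x R -> T*Q -> Q all read as
  \<open>fst\<close> in suitable charts, so one treatment of chartwise linear maps covers every
  pullback in the contact form.\<close>

lemma times_differentiable_on_cong:
  assumes "open S" "\<And>x. x \<in> S \<Longrightarrow> f x = g x" "times_differentiable_on n S f"
  shows "times_differentiable_on n S g"
  using assms(2,3)
proof (induction n arbitrary: f g)
  case 0
  then show ?case by (simp cong: continuous_on_cong)
next
  case (Suc n)
  have der: "(g has_derivative frechet_derivative f (at x)) (at x)" if "x \<in> S" for x
    by (rule has_derivative_transform_within_open[of f _ x UNIV S g])
      (use Suc.prems that \<open>open S\<close> in \<open>auto simp: frechet_derivative_works[symmetric]\<close>)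
  have eq: "frechet_derivative f (at x) v = frechet_derivative g (at x) v" if "x \<in> S" for x v
    using frechet_derivative_at[OF der[OF that]] by simp
  show ?case
    using der Suc.IH[of "\<lambda>x. frechet_derivative f (at x) _" "\<lambda>x. frechet_derivative g (at x) _"] eq Suc.prems(2)
    by (auto simp: differentiable_def)
qed

text \<open>\<open>frechet_derivative\<close> is a choice term; this rule lets any explicit formula
  \<open>f'\<close> for the derivative take its place, and the inductions below all pass through
  it.\<close>

lemma times_differentiable_on_SucI:
  assumes "open S" "\<And>x. x \<in> S \<Longrightarrow> (f has_derivative f' x) (at x)"
    "\<And>v. times_differentiable_on n S (\<lambda>x. f' x v)"
  shows "times_differentiable_on (Suc n) S f"
proof -
  have "f' x v = frechet_derivative f (at x) v" if "x \<in> S" for x v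
    using frechet_derivative_at[OF assms(2)[OF that]] by simp
  then show ?thesis
    using assms(2) times_differentiable_on_cong[OF assms(1) _ assms(3)]
    by (auto simp: differentiable_def)
qed

text \<open>Level \<open>Suc n\<close> does not contain level \<open>n\<close> by definition. The
  inclusion is inherited by the directional derivatives and starts from the continuity of
  differentiable maps.\<close>

lemma times_differentiable_on_SucD:
  assumes "times_differentiable_on (Suc n) S f"
  shows "times_differentiable_on n S f"
  using assms
proof (induction n arbitrary: f)
  case 0
  then show ?case
    by (auto intro!: continuous_at_imp_continuous_on differentiable_imp_continuous_within)
next
  case (Suc n)
  then show ?case by (metis times_differentiable_on.simps(2))
qed

lemma times_differentiable_on_has_derivative:
  assumes "times_differentiable_on (Suc n) S f" "x \<in> S"
  shows "(f has_derivative frechet_derivative f (at x)) (at x)"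
  using assms by (simp add: frechet_derivative_works[symmetric])

lemma times_differentiable_on_subset:
  assumes "times_differentiable_on n S f" "T \<subseteq> S"
  shows "times_differentiable_on n T f"
  using assms by (induction n arbitrary: f) (auto intro: continuous_on_subset)

lemma times_differentiable_on_const: "open S \<Longrightarrow> times_differentiable_on n S (\<lambda>x. c)"
  by (induction n arbitrary: c) auto

lemma times_differentiable_on_linear:
  assumes "open S" "bounded_linear L" "times_differentiable_on n S f"
  shows "times_differentiable_on n S (\<lambda>x. L (f x))"
  using assms(3)
proof (induction n arbitrary: f)
  case 0
  then show ?case using assms(2) by (auto intro: bounded_linear.continuous_on)
next
  case (Suc n)
  show ?case
  proof (rule times_differentiable_on_SucI[OF assms(1)])
    show "((\<lambda>x. L (f x)) has_derivative (\<lambda>v. L (frechet_derivative f (at x) v))) (at x)"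
      if "x \<in> S" for x
      by (rule bounded_linear.has_derivative[OF assms(2) times_differentiable_on_has_derivative[OF Suc.prems that]])
    show "times_differentiable_on n S (\<lambda>x. L (frechet_derivative f (at x) v))" for v
      using Suc by simp
  qed
qed

lemma times_differentiable_on_add:
  assumes "open S" "times_differentiable_on n S f" "times_differentiable_on n S g"
  shows "times_differentiable_on n S (\<lambda>x. f x + g x)"
  using assms(2,3)
proof (induction n arbitrary: f g)
  case 0
  then show ?case by (auto intro: continuous_on_add)
next
  case (Suc n)
  show ?case
    by (rule times_differentiable_on_SucI[OF assms(1) has_derivative_add
          [OF times_differentiable_on_has_derivative[OF Suc.prems(1)]
            times_differentiable_on_has_derivative[OF Suc.prems(2)]]])
      (use Suc in auto)
qed

text \<open>The product rule yields two terms of the same bilinear shape, so the induction closes;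
  the undifferentiated factor in each of them has to be lowered by one level first.\<close>

lemma (in bounded_bilinear) times_differentiable_on_bilinear:
  assumes "open S" "times_differentiable_on n S f" "times_differentiable_on n S g"
  shows "times_differentiable_on n S (\<lambda>x. prod (f x) (g x))"
  using assms(2,3)
proof (induction n arbitrary: f g)
  case 0
  then show ?case by (auto intro: continuous_on)
next
  case (Suc n)
  show ?case
    by (rule times_differentiable_on_SucI[OF assms(1) FDERIV
          [OF times_differentiable_on_has_derivative[OF Suc.prems(1)]
            times_differentiable_on_has_derivative[OF Suc.prems(2)]]])
      (use Suc Suc.prems[THEN times_differentiable_on_SucD]
        in \<open>auto intro!: times_differentiable_on_add assms(1)\<close>)
qed

lemma times_differentiable_on_sum:
  assumes "open S" "\<And>i. i \<in> I \<Longrightarrow> times_differentiable_on n S (f i)"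
  shows "times_differentiable_on n S (\<lambda>x. \<Sum>i\<in>I. f i x)"
  using assms(2)
  by (induction I rule: infinite_finite_induct)
    (simp_all add: times_differentiable_on_const times_differentiable_on_add assms(1))

section \<open>Closure properties of smooth maps\<close>

lemma smooth_on_differentiable: "smooth_on S f \<Longrightarrow> x \<in> S \<Longrightarrow> f differentiable (at x)"
  unfolding smooth_on_def by (metis times_differentiable_on.simps(2))

lemma smooth_on_has_derivative:
  "smooth_on S f \<Longrightarrow> x \<in> S \<Longrightarrow> (f has_derivative frechet_derivative f (at x)) (at x)"
  using smooth_on_differentiable frechet_derivative_works by blast

lemma smooth_on_linear_derivative: "smooth_on S f \<Longrightarrow> x \<in> S \<Longrightarrow> linear (frechet_derivative f (at x))"
  using smooth_on_differentiable linear_frechet_derivative by blast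

lemma smooth_on_derivative: "smooth_on S f \<Longrightarrow> smooth_on S (\<lambda>x. frechet_derivative f (at x) v)"
  unfolding smooth_on_def by (metis times_differentiable_on.simps(2))

lemma smooth_on_continuous_on: "smooth_on S f \<Longrightarrow> continuous_on S f"
  unfolding smooth_on_def by (metis times_differentiable_on.simps(1))

lemma smooth_on_cong:
  "open S \<Longrightarrow> (\<And>x. x \<in> S \<Longrightarrow> f x = g x) \<Longrightarrow> smooth_on S f \<Longrightarrow> smooth_on S g"
  unfolding smooth_on_def using times_differentiable_on_cong by blast

lemma smooth_on_subset: "smooth_on S f \<Longrightarrow> T \<subseteq> S \<Longrightarrow> smooth_on T f"
  unfolding smooth_on_def using times_differentiable_on_subset by blast

lemma smooth_on_const: "open S \<Longrightarrow> smooth_on S (\<lambda>x. c)"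
  unfolding smooth_on_def using times_differentiable_on_const by blast

lemma smooth_on_linear: "open S \<Longrightarrow> bounded_linear L \<Longrightarrow> smooth_on S f \<Longrightarrow> smooth_on S (\<lambda>x. L (f x))"
  by (simp add: smooth_on_def times_differentiable_on_linear)

lemma smooth_on_ident:
  assumes "open S"
  shows "smooth_on S (\<lambda>x. x)"
  unfolding smooth_on_def
proof
  show "times_differentiable_on n S (\<lambda>x. x)" for n
    by (cases n) (use assms times_differentiable_on_const in auto)
qed

lemma smooth_on_add: "open S \<Longrightarrow> smooth_on S f \<Longrightarrow> smooth_on S g \<Longrightarrow> smooth_on S (\<lambda>x. f x + g x)"
  by (simp add: smooth_on_def times_differentiable_on_add)

lemma smooth_on_sum:
  "open S \<Longrightarrow> (\<And>i. i \<in> I \<Longrightarrow> smooth_on S (f i)) \<Longrightarrow> smooth_on S (\<lambda>x. \<Sum>i\<in>I. f i x)"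
  by (simp add: smooth_on_def times_differentiable_on_sum)

lemma smooth_on_scaleR:
  "open S \<Longrightarrow> smooth_on S f \<Longrightarrow> smooth_on S g \<Longrightarrow> smooth_on S (\<lambda>x. f x *\<^sub>R g x)"
  by (simp add: smooth_on_def bounded_bilinear.times_differentiable_on_bilinear[OF bounded_bilinear_scaleR])

lemma smooth_on_mult:
  "open S \<Longrightarrow> smooth_on S f \<Longrightarrow> smooth_on S g \<Longrightarrow> smooth_on S (\<lambda>x. f x * g x :: real)"
  using smooth_on_scaleR[of S f g] by simp

lemma smooth_on_minus: "open S \<Longrightarrow> smooth_on S f \<Longrightarrow> smooth_on S (\<lambda>x. - f x)"
  using smooth_on_linear[OF _ bounded_linear_minus[OF bounded_linear_ident]] .

lemma smooth_on_diff: "open S \<Longrightarrow> smooth_on S f \<Longrightarrow> smooth_on S g \<Longrightarrow> smooth_on S (\<lambda>x. f x - g x)"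
  using smooth_on_add[OF _ _ smooth_on_minus[of S g], of f] by simp

lemma smooth_on_inner:
  "open S \<Longrightarrow> smooth_on S f \<Longrightarrow> smooth_on S g \<Longrightarrow> smooth_on S (\<lambda>x. f x \<bullet> g x)"
  by (simp add: smooth_on_def bounded_bilinear.times_differentiable_on_bilinear[OF bounded_bilinear_inner])

lemma smooth_on_Pair:
  assumes "open S" "smooth_on S f" "smooth_on S g"
  shows "smooth_on S (\<lambda>x. (f x, g x))"
proof -
  have "bounded_linear (\<lambda>x. (x, 0))" "bounded_linear (\<lambda>x. (0, x))"
    by (intro bounded_linear_Pair bounded_linear_ident bounded_linear_zero)+
  from smooth_on_add[OF assms(1) smooth_on_linear[OF assms(1) this(1) assms(2)]
      smooth_on_linear[OF assms(1) this(2) assms(3)]]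
  show ?thesis by simp
qed

text \<open>Derivatives are taken at \<open>x\<close> in the full space, so each level is a
  condition near the single points, and the neighbourhoods \<open>T\<close> may leave
  \<open>S\<close>.\<close>

lemma smooth_on_locally:
  assumes "\<And>x. x \<in> S \<Longrightarrow> \<exists>T. open T \<and> x \<in> T \<and> smooth_on T f"
  shows "smooth_on S f"
  unfolding smooth_on_def
proof
  fix n
  have "\<And>x. x \<in> S \<Longrightarrow> \<exists>T. open T \<and> x \<in> T \<and> times_differentiable_on n T f"
    using assms unfolding smooth_on_def by blast
  then show "times_differentiable_on n S f"
  proof (induction n arbitrary: f)
    case 0
    show ?case unfolding times_differentiable_on.simps
    proof (rule continuous_at_imp_continuous_on, rule ballI)
      show "continuous (at x) f" if "x \<in> S" for x
        using 0[OF that] by (auto simp: continuous_on_eq_continuous_at)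
    qed
  next
    case (Suc n)
    have "\<exists>T. open T \<and> x \<in> T \<and> times_differentiable_on n T (\<lambda>x. frechet_derivative f (at x) v)"
      if "x \<in> S" for x v using Suc.prems[OF that] by auto
    moreover have "f differentiable (at x)" if "x \<in> S" for x using Suc.prems[OF that] by auto
    ultimately show ?case using Suc.IH by simp
  qed
qed

subsection \<open>Parseval frames and the chain rule\<close>

text \<open>The model spaces are not of class \<open>euclidean_space\<close>, so \<open>Basis\<close> is not available; the
  reproducing identity is all that is needed of an orthonormal basis.\<close>

definition parseval_frame :: "'e::real_inner set \<Rightarrow> bool" where
  "parseval_frame B \<longleftrightarrow> finite B \<and> (\<forall>x. (\<Sum>b\<in>B. (x \<bullet> b) *\<^sub>R b) = x)"

lemma parseval_frame_sum: "parseval_frame B \<Longrightarrow> (\<Sum>b\<in>B. (x \<bullet> b) *\<^sub>R b) = x"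
  by (simp add: parseval_frame_def)

lemma parseval_frame_linear:
  assumes "parseval_frame B" "linear L"
  shows "L x = (\<Sum>b\<in>B. (x \<bullet> b) *\<^sub>R L b)"
proof -
  interpret L: linear L by fact
  have "L x = L (\<Sum>b\<in>B. (x \<bullet> b) *\<^sub>R b)" by (simp add: parseval_frame_sum[OF assms(1)])
  then show ?thesis by (simp add: L.sum L.scaleR)
qed

text \<open>Gram-Schmidt gives an orthogonal spanning set; the reproducing identity holds on its
  elements and extends to the span by linearity.\<close>

lemma parseval_frame_exists:
  assumes "finite (B :: 'e::real_inner set)" "span B = UNIV"
  shows "\<exists>C::'e set. parseval_frame C"
proof -
  obtain C :: "'e set" where C: "finite C" "span C = UNIV" "pairwise orthogonal C"
    using basis_orthogonal[OF assms(1)] assms(2) by metis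
  \<comment> \<open>If \<open>C\<close> contains 0, division by its norm gives 0 again, so that
    summand vanishes.\<close>
  let ?n = "\<lambda>c::'e. c /\<^sub>R norm c"
  have in_span: "x \<in> span C" for x using C(2) by simp
  have eq: "(\<Sum>c\<in>C. (x \<bullet> ?n c) *\<^sub>R ?n c) = x" for x
    using in_span[of x]
  proof (induction rule: span_induct_alt)
    case base
    then show ?case by simp
  next
    case (step r c y)
    have "(\<Sum>d\<in>C. (c \<bullet> ?n d) *\<^sub>R ?n d) = (\<Sum>d\<in>C. if d = c then c else 0)"
    proof (rule sum.cong)
      fix d assume "d \<in> C"
      then show "(c \<bullet> ?n d) *\<^sub>R ?n d = (if d = c then c else 0)"
        using C(3) step.hyps
        by (cases "c = 0") (auto simp: pairwise_def orthogonal_def dot_square_norm power2_eq_square field_simps)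
    qed simp
    then have "(\<Sum>d\<in>C. (c \<bullet> ?n d) *\<^sub>R ?n d) = c"
      using C(1) step.hyps by simp
    moreover have "(\<Sum>d\<in>C. ((r *\<^sub>R c + y) \<bullet> ?n d) *\<^sub>R ?n d)
      = r *\<^sub>R (\<Sum>d\<in>C. (c \<bullet> ?n d) *\<^sub>R ?n d) + (\<Sum>d\<in>C. (y \<bullet> ?n d) *\<^sub>R ?n d)"
      by (simp add: inner_add_left algebra_simps sum.distrib scaleR_sum_right)
    ultimately show ?case using step.IH by simp
  qed
  \<comment> \<open>The sum over the family indexed by \<open>C\<close> must become a sum over a set
    of unit vectors. Normalisation merges none of the nonzero elements, since a common value of two
    orthogonal ones would be orthogonal to itself.\<close>
  let ?E = "?n ` (C - {0})"
  have "inj_on ?n (C - {0})"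
  proof (rule inj_onI, rule ccontr)
    fix c d assume cd: "c \<in> C - {0}" "d \<in> C - {0}" "?n c = ?n d" "c \<noteq> d"
    then have "c \<bullet> d = 0" using C(3) by (auto simp: pairwise_def orthogonal_def)
    then have "?n c \<bullet> ?n d = 0" by simp
    then have "?n c \<bullet> ?n c = 0" by (simp only: cd(3)[symmetric])
    then show False using cd(1) by auto
  qed
  then have "(\<Sum>b\<in>?E. (x \<bullet> b) *\<^sub>R b) = (\<Sum>c\<in>C - {0}. (x \<bullet> ?n c) *\<^sub>R ?n c)" for x
    by (simp add: sum.reindex)
  also have "(\<Sum>c\<in>C - {0}. (x \<bullet> ?n c) *\<^sub>R ?n c) = (\<Sum>c\<in>C. (x \<bullet> ?n c) *\<^sub>R ?n c)" for x
    by (rule sum.mono_neutral_left) (use C(1) in auto)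
  finally show ?thesis
    using eq C(1) by (intro exI[of _ ?E]) (auto simp: parseval_frame_def)
qed

lemma parseval_frame_real: "parseval_frame {1::real}"
  by (simp add: parseval_frame_def)

lemma parseval_frame_prod:
  fixes B :: "'e::real_inner set" and C :: "'f::real_inner set"
  assumes "parseval_frame B" "parseval_frame C"
  shows "parseval_frame ((\<lambda>b. (b, 0)) ` B \<union> Pair 0 ` C :: ('e \<times> 'f) set)"
proof -
  let ?B = "(\<lambda>b. (b, 0)) ` B :: ('e \<times> 'f) set" and ?C = "Pair 0 ` C :: ('e \<times> 'f) set"
  have fin: "finite ?B" "finite ?C" using assms by (auto simp: parseval_frame_def)
  let ?g = "\<lambda>x b. (x \<bullet> b) *\<^sub>R b :: 'e \<times> 'f"
  have "sum (?g x) (?B \<union> ?C) = x" for x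
  proof -
    \<comment> \<open>A Parseval frame may contain 0, so the two halves can share the point (0, 0);
      its contribution is 0.\<close>
    have "sum (?g x) (?B \<inter> ?C) = 0" by (rule sum.neutral) (auto simp: inner_prod_def)
    then have "sum (?g x) (?B \<union> ?C) = sum (?g x) ?B + sum (?g x) ?C"
      using sum.union_inter[OF fin, of "?g x"] by simp
    also have "sum (?g x) ?B = (\<Sum>b\<in>B. ((fst x \<bullet> b) *\<^sub>R b, 0))"
      by (subst sum.reindex) (auto simp: inj_on_def inner_prod_def)
    also have "\<dots> = (fst x, 0)"
      using parseval_frame_sum[OF assms(1)] by (simp add: sum_prod)
    also have "sum (?g x) ?C = (\<Sum>b\<in>C. (0, (snd x \<bullet> b) *\<^sub>R b))"
      by (subst sum.reindex) (auto simp: inj_on_def inner_prod_def)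
    also have "\<dots> = (0, snd x)"
      using parseval_frame_sum[OF assms(2)] by (simp add: sum_prod)
    finally show ?thesis by simp
  qed
  then show ?thesis using fin by (simp add: parseval_frame_def)
qed

text \<open>In the chain rule the direction fed to the derivative of \<open>g\<close> varies with
  \<open>x\<close>, whereas smoothness controls derivatives in fixed directions. Expanding over the
  frame turns the expression into products of components of the derivative of \<open>f\<close> with
  derivatives of \<open>g\<close> along fixed \<open>b\<close>, to which the induction hypothesis
  applies.\<close>

lemma smooth_on_compose:
  fixes f :: "'a::real_normed_vector \<Rightarrow> 'e::real_inner" and g :: "'e \<Rightarrow> 'b::real_normed_vector"
  assumes B: "parseval_frame (B :: 'e set)" and S: "open S" and f: "smooth_on S f" and g: "smooth_on T g"
    and fS: "f ` S \<subseteq> T"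
  shows "smooth_on S (\<lambda>x. g (f x))"
  unfolding smooth_on_def
proof
  show "times_differentiable_on n S (\<lambda>x. g (f x))" for n
    using g
  proof (induction n arbitrary: g)
    case 0
    show ?case
      using continuous_on_compose2[OF smooth_on_continuous_on[OF 0] smooth_on_continuous_on[OF f] fS] by simp
  next
    case (Suc n)
    show ?case
    proof (rule times_differentiable_on_SucI[OF S])
      fix x assume x: "x \<in> S"
      let ?L = "frechet_derivative g (at (f x))"
      have g': "(g has_derivative ?L) (at (f x))" and L: "linear ?L"
        using smooth_on_has_derivative[OF Suc.prems] smooth_on_linear_derivative[OF Suc.prems] x fS by auto
      have "((\<lambda>x. g (f x)) has_derivative (\<lambda>v. ?L (frechet_derivative f (at x) v))) (at x)"
        by (rule has_derivative_compose[OF smooth_on_has_derivative[OF f x] g'])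
      then show "((\<lambda>x. g (f x)) has_derivative
          (\<lambda>v. \<Sum>b\<in>B. (frechet_derivative f (at x) v \<bullet> b) *\<^sub>R ?L b)) (at x)"
        by (rule has_derivative_eq_rhs) (rule ext, rule parseval_frame_linear[OF B L])
    next
      fix v
      show "times_differentiable_on n S
         (\<lambda>x. \<Sum>b\<in>B. (frechet_derivative f (at x) v \<bullet> b) *\<^sub>R frechet_derivative g (at (f x)) b)"
      proof (intro times_differentiable_on_sum S
          bounded_bilinear.times_differentiable_on_bilinear[OF bounded_bilinear_scaleR])
        fix b
        show "times_differentiable_on n S (\<lambda>x. frechet_derivative f (at x) v \<bullet> b)"
          using smooth_on_inner[OF S smooth_on_derivative[OF f] smooth_on_const[OF S]]
          by (simp add: smooth_on_def)
        show "times_differentiable_on n S (\<lambda>x. frechet_derivative g (at (f x)) b)"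
          by (rule Suc.IH[OF smooth_on_derivative[OF Suc.prems]])
      qed
    qed
  qed
qed

subsection \<open>Symmetry of second derivatives\<close>

lemma has_derivative_along_line:
  fixes f :: "'e::real_normed_vector \<Rightarrow> real"
  assumes "f differentiable (at (y + a *\<^sub>R u))"
  shows "((\<lambda>a. f (y + a *\<^sub>R u)) has_real_derivative frechet_derivative f (at (y + a *\<^sub>R u)) u) (at a)"
proof -
  let ?L = "frechet_derivative f (at (y + a *\<^sub>R u))"
  have "((\<lambda>a. y + a *\<^sub>R u) has_derivative (\<lambda>s. s *\<^sub>R u)) (at a)"
    by (auto intro!: derivative_eq_intros)
  from has_derivative_compose[OF this, of f ?L]
  have "((\<lambda>a. f (y + a *\<^sub>R u)) has_derivative (\<lambda>s. ?L (s *\<^sub>R u))) (at a)"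
    using assms by (simp add: frechet_derivative_works[symmetric])
  moreover have "?L (s *\<^sub>R u) = ?L u * s" for s
    using linear_cmul[OF linear_frechet_derivative[OF assms]] by simp
  ultimately show ?thesis by (simp add: has_field_derivative_def)
qed

text \<open>The mean value theorem is used twice: along \<open>u\<close> for the increment of
  \<open>f\<close> in direction \<open>s *\<^sub>R v\<close>, then along \<open>v\<close> for the
  resulting derivative in direction \<open>u\<close>.\<close>

lemma second_difference_mvt:
  fixes f :: "'e::real_normed_vector \<Rightarrow> real"
  assumes s: "0 < s"
    and S: "\<And>a b. 0 \<le> a \<Longrightarrow> a \<le> s \<Longrightarrow> 0 \<le> b \<Longrightarrow> b \<le> s \<Longrightarrow> x + a *\<^sub>R u + b *\<^sub>R v \<in> S"
    and f: "smooth_on S f"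
  obtains a b where "0 < a" "a < s" "0 < b" "b < s"
    "f (x + s *\<^sub>R u + s *\<^sub>R v) - f (x + s *\<^sub>R u) - f (x + s *\<^sub>R v) + f x =
      s * (s * frechet_derivative (\<lambda>y. frechet_derivative f (at y) u) (at (x + a *\<^sub>R u + b *\<^sub>R v)) v)"
proof -
  let ?k = "\<lambda>a. f (x + s *\<^sub>R v + a *\<^sub>R u) - f (x + a *\<^sub>R u)"
  let ?k' = "\<lambda>a. frechet_derivative f (at (x + s *\<^sub>R v + a *\<^sub>R u)) u - frechet_derivative f (at (x + a *\<^sub>R u)) u"
  have "\<exists>a>0. a < s \<and> ?k s - ?k 0 = (s - 0) * ?k' a"
  proof (rule MVT2[OF s])
    fix a assume a: "0 \<le> a" "a \<le> s"
    show "(?k has_real_derivative ?k' a) (at a)"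
      using a s S[of a 0] S[of a s]
      by (intro DERIV_diff has_derivative_along_line smooth_on_differentiable[OF f])
        (simp_all add: add.commute add.left_commute)
  qed
  then obtain a where a: "0 < a" "a < s" "?k s - ?k 0 = s * ?k' a" by auto
  let ?g = "\<lambda>y. frechet_derivative f (at y) u"
  have "\<exists>b>0. b < s \<and> ?g (x + a *\<^sub>R u + s *\<^sub>R v) - ?g (x + a *\<^sub>R u + 0 *\<^sub>R v)
      = (s - 0) * frechet_derivative ?g (at (x + a *\<^sub>R u + b *\<^sub>R v)) v"
  proof (rule MVT2[OF s])
    fix b assume b: "0 \<le> b" "b \<le> s"
    show "((\<lambda>b. ?g (x + a *\<^sub>R u + b *\<^sub>R v)) has_real_derivative
        frechet_derivative ?g (at (x + a *\<^sub>R u + b *\<^sub>R v)) v) (at b)"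
      using a b S[of a b]
      by (intro has_derivative_along_line smooth_on_differentiable[OF smooth_on_derivative[OF f]]) auto
  qed
  then obtain b where b: "0 < b" "b < s" "?g (x + a *\<^sub>R u + s *\<^sub>R v) - ?g (x + a *\<^sub>R u)
      = s * frechet_derivative ?g (at (x + a *\<^sub>R u + b *\<^sub>R v)) v" by auto
  have "?k' a = s * frechet_derivative ?g (at (x + a *\<^sub>R u + b *\<^sub>R v)) v"
    using b(3) by (simp add: algebra_simps)
  then show ?thesis using a b
    by (intro that[of a b]) (simp_all add: algebra_simps)
qed

text \<open>The second difference does not change when \<open>u\<close> and \<open>v\<close> are
  exchanged, so arbitrarily close to \<open>x\<close> the two mixed derivatives share a value,
  possibly at different points. Continuity at \<open>x\<close> then excludes a gap.\<close>

lemma smooth_on_second_derivative_commute: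
  fixes f :: "'e::real_normed_vector \<Rightarrow> real"
  assumes S: "open S" and f: "smooth_on S f" and x: "x \<in> S"
  shows "frechet_derivative (\<lambda>y. frechet_derivative f (at y) u) (at x) v =
    frechet_derivative (\<lambda>y. frechet_derivative f (at y) v) (at x) u"
    (is "?F x = ?G x")
proof (rule ccontr)
  assume neq: "?F x \<noteq> ?G x"
  \<comment> \<open>With half the gap as tolerance, a value closer than \<open>e\<close> to
    \<open>?F x\<close> cannot also be closer than \<open>e\<close> to \<open>?G x\<close>.\<close>
  define e where "e = \<bar>?F x - ?G x\<bar> / 2"
  have e: "e > 0" using neq by (simp add: e_def)
  have cont: "continuous (at x) ?F" "continuous (at x) ?G"
    using smooth_on_continuous_on[OF smooth_on_derivative[OF smooth_on_derivative[OF f]]] S x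
    by (auto simp: continuous_on_eq_continuous_at)
  obtain d1 where d1: "d1 > 0" "\<And>y. dist y x < d1 \<Longrightarrow> dist (?F y) (?F x) < e"
    using cont(1) e unfolding continuous_at_eps_delta by blast
  obtain d2 where d2: "d2 > 0" "\<And>y. dist y x < d2 \<Longrightarrow> dist (?G y) (?G x) < e"
    using cont(2) e unfolding continuous_at_eps_delta by blast
  obtain d3 where d3: "d3 > 0" "ball x d3 \<subseteq> S"
    using S x openE by blast
  define d where "d = min d1 (min d2 d3)"
  have d: "d > 0" using d1 d2 d3 by (simp add: d_def)
  \<comment> \<open>The summand 1 keeps \<open>N\<close> positive when \<open>u\<close> and
    \<open>v\<close> both vanish; the choice of \<open>s\<close> then puts the whole parallelogram
    within \<open>d / 2\<close> of \<open>x\<close>.\<close>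
  define N where "N = norm u + norm v + 1"
  define s where "s = d / N / 2"
  have pos: "N > 0" unfolding N_def by (smt (verit) norm_ge_zero)
  then have s: "s > 0" using d by (simp add: s_def)
  have near: "dist (x + a *\<^sub>R u + b *\<^sub>R v) x < d" if "0 \<le> a" "a \<le> s" "0 \<le> b" "b \<le> s" for a b
  proof -
    have "dist (x + a *\<^sub>R u + b *\<^sub>R v) x \<le> norm (a *\<^sub>R u) + norm (b *\<^sub>R v)"
      by (simp add: dist_norm add.assoc norm_triangle_ineq del: norm_scaleR)
    also have "\<dots> \<le> s * norm u + s * norm v"
      using that by (intro add_mono) (auto intro: mult_right_mono)
    also have "\<dots> \<le> s * N" using s by (simp add: N_def algebra_simps)
    also have "\<dots> = d / 2" using pos by (simp add: s_def)
    finally show ?thesis using d by simp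
  qed
  have S1: "x + a *\<^sub>R u + b *\<^sub>R v \<in> S" if "0 \<le> a" "a \<le> s" "0 \<le> b" "b \<le> s" for a b
    using near[OF that] d3(2) by (auto simp: d_def dist_commute)
  obtain a b where ab: "0 < a" "a < s" "0 < b" "b < s"
    "f (x + s *\<^sub>R u + s *\<^sub>R v) - f (x + s *\<^sub>R u) - f (x + s *\<^sub>R v) + f x
      = s * (s * ?F (x + a *\<^sub>R u + b *\<^sub>R v))"
    by (rule second_difference_mvt[OF s S1 f])
  have S2: "x + a *\<^sub>R v + b *\<^sub>R u \<in> S" if "0 \<le> a" "a \<le> s" "0 \<le> b" "b \<le> s" for a b
    using S1[of b a] that by (simp add: ac_simps)
  obtain a' b' where ab': "0 < a'" "a' < s" "0 < b'" "b' < s"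
    "f (x + s *\<^sub>R v + s *\<^sub>R u) - f (x + s *\<^sub>R v) - f (x + s *\<^sub>R u) + f x
      = s * (s * ?G (x + a' *\<^sub>R v + b' *\<^sub>R u))"
    by (rule second_difference_mvt[OF s S2 f])
  have swap: "x + b' *\<^sub>R u + a' *\<^sub>R v = x + a' *\<^sub>R v + b' *\<^sub>R u"
    "x + s *\<^sub>R v + s *\<^sub>R u = x + s *\<^sub>R u + s *\<^sub>R v" by simp_all
  have "s * (s * ?F (x + a *\<^sub>R u + b *\<^sub>R v)) = s * (s * ?G (x + b' *\<^sub>R u + a' *\<^sub>R v))"
    using ab(5) ab'(5) unfolding swap by linarith
  then have "?F (x + a *\<^sub>R u + b *\<^sub>R v) = ?G (x + b' *\<^sub>R u + a' *\<^sub>R v)"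
    using s by simp
  moreover have "dist (?F (x + a *\<^sub>R u + b *\<^sub>R v)) (?F x) < e"
    using near[of a b] ab by (intro d1) (simp add: d_def)
  moreover have "dist (?G (x + b' *\<^sub>R u + a' *\<^sub>R v)) (?G x) < e"
    using near[of b' a'] ab' by (intro d2) (simp add: d_def)
  ultimately show False by (simp add: e_def dist_real_def abs_if split: if_splits)
qed

subsection \<open>Smooth functions on an atlas\<close>

text \<open>The frame serves twice: it gives the chain rule in the model space, and its vectors
  \<open>b\<close> index the coordinate functions \<open>\<phi> x \<bullet> b\<close> of a
  chart.\<close>

locale smooth_atlas_frame =
  fixes A :: "('a, 'e::real_inner) atlas" and B :: "'e set"
  assumes smooth_atlas: "smooth_atlas A" and frame: "parseval_frame B"
begin

lemma chart_inj: "(D, \<phi>) \<in> A \<Longrightarrow> inj_on \<phi> D"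
  using smooth_atlas by (auto simp: smooth_atlas_def)

lemma chart_image_open: "(D, \<phi>) \<in> A \<Longrightarrow> open (\<phi> ` D)"
  using smooth_atlas by (auto simp: smooth_atlas_def)

lemma transition_domain_open: "(D, \<phi>) \<in> A \<Longrightarrow> (E, \<psi>) \<in> A \<Longrightarrow> open (\<phi> ` (D \<inter> E))"
  using smooth_atlas by (fastforce simp: smooth_atlas_def)

lemma transition_smooth:
  "(D, \<phi>) \<in> A \<Longrightarrow> (E, \<psi>) \<in> A \<Longrightarrow> smooth_on (\<phi> ` (D \<inter> E)) (\<lambda>y. \<psi> (inv_into D \<phi> y))"
  using smooth_atlas unfolding smooth_atlas_def o_def by fast

lemma inv_chart: "(D, \<phi>) \<in> A \<Longrightarrow> x \<in> D \<Longrightarrow> inv_into D \<phi> (\<phi> x) = x"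
  by (simp add: chart_inj)

lemma chart_subset: "(D, \<phi>) \<in> A \<Longrightarrow> D \<subseteq> atlas_space A"
  by (auto simp: atlas_space_def)

lemma in_chartE:
  assumes "p \<in> atlas_space A"
  obtains D \<phi> where "(D, \<phi>) \<in> A" "p \<in> D"
  using assms by (auto simp: atlas_space_def)

lemma atlas_open_image: "atlas_open A U \<Longrightarrow> (D, \<phi>) \<in> A \<Longrightarrow> open (\<phi> ` (U \<inter> D))"
  by (auto simp: atlas_open_def)

lemma atlas_open_Int: "atlas_open A U \<Longrightarrow> atlas_open A V \<Longrightarrow> atlas_open A (U \<inter> V)"
  using openin_Int openin_atlas_topology[OF smooth_atlas] by metis

lemma atlas_open_locally:
  assumes "\<And>p. p \<in> U \<Longrightarrow> \<exists>V. atlas_open A V \<and> p \<in> V \<and> V \<subseteq> U"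
  shows "atlas_open A U"
  using openin_subopen[of "atlas_topology A" U] assms openin_atlas_topology[OF smooth_atlas] by metis

lemma atlas_open_chart:
  assumes "(D, \<phi>) \<in> A"
  shows "atlas_open A D"
  using assms chart_subset[OF assms] transition_domain_open
  by (auto simp: atlas_open_def Int_commute)

lemma atlas_open_space: "atlas_open A (atlas_space A)"
  by (rule atlas_open_locally) (metis in_chartE atlas_open_chart chart_subset)

lemma smooth_fun_onD:
  "smooth_fun_on A U f \<Longrightarrow> (D, \<phi>) \<in> A \<Longrightarrow> smooth_on (\<phi> ` (U \<inter> D)) (\<lambda>y. f (inv_into D \<phi> y))"
  unfolding smooth_fun_on_def o_def by fast

lemma smooth_fun_onI:
  assumes "\<And>D \<phi>. (D, \<phi>) \<in> A \<Longrightarrow> smooth_on (\<phi> ` (U \<inter> D)) (\<lambda>y. f (inv_into D \<phi> y))"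
  shows "smooth_fun_on A U f"
  using assms unfolding smooth_fun_on_def o_def by fast

lemma smooth_fun_on_subset: "smooth_fun_on A U f \<Longrightarrow> V \<subseteq> U \<Longrightarrow> smooth_fun_on A V f"
  by (rule smooth_fun_onI) (rule smooth_on_subset[OF smooth_fun_onD], auto)

lemma smooth_fun_on_cong:
  assumes "atlas_open A U" "\<And>x. x \<in> U \<Longrightarrow> f x = g x" "smooth_fun_on A U f"
  shows "smooth_fun_on A U g"
proof (rule smooth_fun_onI)
  fix D \<phi> assume c: "(D, \<phi>) \<in> A"
  show "smooth_on (\<phi> ` (U \<inter> D)) (\<lambda>y. g (inv_into D \<phi> y))"
    by (rule smooth_on_cong[OF atlas_open_image[OF assms(1) c] _ smooth_fun_onD[OF assms(3) c]])
      (use c assms(2) in \<open>auto simp: inv_chart\<close>)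
qed

lemma smooth_fun_on_locally:
  assumes "\<And>p. p \<in> U \<Longrightarrow> \<exists>V. atlas_open A V \<and> p \<in> V \<and> smooth_fun_on A V f"
  shows "smooth_fun_on A U f"
proof (rule smooth_fun_onI, rule smooth_on_locally)
  fix D \<phi> y assume c: "(D, \<phi>) \<in> A" and "y \<in> \<phi> ` (U \<inter> D)"
  then obtain p where p: "p \<in> U" "p \<in> D" "y = \<phi> p" by auto
  then obtain V where V: "atlas_open A V" "p \<in> V" "smooth_fun_on A V f" using assms by blast
  show "\<exists>T. open T \<and> y \<in> T \<and> smooth_on T (\<lambda>y. f (inv_into D \<phi> y))"
    using atlas_open_image[OF V(1) c] smooth_fun_onD[OF V(3) c] V(2) p by blast
qed

lemma smooth_fun_on_const: "atlas_open A U \<Longrightarrow> smooth_fun_on A U (\<lambda>x. c)"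
  by (rule smooth_fun_onI, rule smooth_on_const, erule (1) atlas_open_image)

lemma smooth_fun_on_add:
  "atlas_open A U \<Longrightarrow> smooth_fun_on A U f \<Longrightarrow> smooth_fun_on A U g \<Longrightarrow> smooth_fun_on A U (\<lambda>x. f x + g x)"
  by (rule smooth_fun_onI, rule smooth_on_add, erule (1) atlas_open_image, erule (1) smooth_fun_onD,
      erule (1) smooth_fun_onD)

lemma smooth_fun_on_diff:
  "atlas_open A U \<Longrightarrow> smooth_fun_on A U f \<Longrightarrow> smooth_fun_on A U g \<Longrightarrow> smooth_fun_on A U (\<lambda>x. f x - g x)"
  by (rule smooth_fun_onI, rule smooth_on_diff, erule (1) atlas_open_image, erule (1) smooth_fun_onD,
      erule (1) smooth_fun_onD)

lemma smooth_fun_on_mult: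
  "atlas_open A U \<Longrightarrow> smooth_fun_on A U f \<Longrightarrow> smooth_fun_on A U g \<Longrightarrow> smooth_fun_on A U (\<lambda>x. f x * g x)"
  by (rule smooth_fun_onI, rule smooth_on_mult, erule (1) atlas_open_image, erule (1) smooth_fun_onD,
      erule (1) smooth_fun_onD)

lemma smooth_fun_on_cmult:
  "atlas_open A U \<Longrightarrow> smooth_fun_on A U f \<Longrightarrow> smooth_fun_on A U (\<lambda>x. c * f x)"
  by (intro smooth_fun_on_mult smooth_fun_on_const)

lemma smooth_fun_on_sum:
  "atlas_open A U \<Longrightarrow> (\<And>i. i \<in> I \<Longrightarrow> smooth_fun_on A U (f i)) \<Longrightarrow> smooth_fun_on A U (\<lambda>x. \<Sum>i\<in>I. f i x)"
  by (rule smooth_fun_onI, rule smooth_on_sum, erule (1) atlas_open_image, rule smooth_fun_onD)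

text \<open>One chart suffices: in any other chart the function is \<open>g\<close> composed with a
  transition map.\<close>

lemma smooth_fun_on_chart:
  assumes c: "(D, \<phi>) \<in> A" and U: "atlas_open A U" "U \<subseteq> D" and g: "smooth_on (\<phi> ` U) g"
  shows "smooth_fun_on A U (\<lambda>x. g (\<phi> x))"
proof (rule smooth_fun_onI)
  fix E \<psi> assume d: "(E, \<psi>) \<in> A"
  show "smooth_on (\<psi> ` (U \<inter> E)) (\<lambda>y. g (\<phi> (inv_into E \<psi> y)))"
  proof (rule smooth_on_compose[OF frame atlas_open_image[OF U(1) d] _ g])
    show "smooth_on (\<psi> ` (U \<inter> E)) (\<lambda>y. \<phi> (inv_into E \<psi> y))"
      by (rule smooth_on_subset[OF transition_smooth[OF d c]]) (use U(2) in auto)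
    show "(\<lambda>y. \<phi> (inv_into E \<psi> y)) ` \<psi> ` (U \<inter> E) \<subseteq> \<phi> ` U"
      using inv_chart[OF d] by auto
  qed
qed

lemma smooth_fun_on_coordinate:
  assumes "(D, \<phi>) \<in> A"
  shows "smooth_fun_on A D (\<lambda>x. \<phi> x \<bullet> b)"
proof -
  note op = chart_image_open[OF assms]
  show ?thesis
    by (rule smooth_fun_on_chart[OF assms atlas_open_chart[OF assms] order_refl
          smooth_on_inner[OF op smooth_on_ident[OF op] smooth_on_const[OF op]]])
qed

section \<open>Functions smooth near a point\<close>

lemma smooth_atI: "atlas_open A U \<Longrightarrow> smooth_fun_on A U f \<Longrightarrow> p \<in> U \<Longrightarrow> smooth_at A p f"
  by (auto simp: smooth_at_def)

lemma smooth_at_coordinate: "(D, \<phi>) \<in> A \<Longrightarrow> p \<in> D \<Longrightarrow> smooth_at A p (\<lambda>x. \<phi> x \<bullet> b)"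
  by (rule smooth_atI[OF atlas_open_chart smooth_fun_on_coordinate])

lemma smooth_at_space: "smooth_at A p f \<Longrightarrow> p \<in> atlas_space A"
  by (auto simp: smooth_at_def atlas_open_def)

lemma smooth_at2E:
  assumes "smooth_at A p f" "smooth_at A p g"
  obtains U where "atlas_open A U" "p \<in> U" "smooth_fun_on A U f" "smooth_fun_on A U g"
proof -
  obtain U V where "atlas_open A U" "p \<in> U" "smooth_fun_on A U f" "atlas_open A V" "p \<in> V" "smooth_fun_on A V g"
    using assms unfolding smooth_at_def by blast
  then show ?thesis
    by (intro that[of "U \<inter> V"]) (auto intro: atlas_open_Int smooth_fun_on_subset)
qed

lemma smooth_at_const: "p \<in> atlas_space A \<Longrightarrow> smooth_at A p (\<lambda>x. c)"
  by (rule smooth_atI[OF atlas_open_space smooth_fun_on_const[OF atlas_open_space]])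

lemma smooth_at_add: "smooth_at A p f \<Longrightarrow> smooth_at A p g \<Longrightarrow> smooth_at A p (\<lambda>x. f x + g x)"
  by (metis smooth_at2E smooth_atI smooth_fun_on_add)

lemma smooth_at_diff: "smooth_at A p f \<Longrightarrow> smooth_at A p g \<Longrightarrow> smooth_at A p (\<lambda>x. f x - g x)"
  by (metis smooth_at2E smooth_atI smooth_fun_on_diff)

lemma smooth_at_mult: "smooth_at A p f \<Longrightarrow> smooth_at A p g \<Longrightarrow> smooth_at A p (\<lambda>x. f x * g x)"
  by (metis smooth_at2E smooth_atI smooth_fun_on_mult)

lemma smooth_at_sum:
  assumes "p \<in> atlas_space A" "\<And>i. i \<in> I \<Longrightarrow> smooth_at A p (f i)"
  shows "smooth_at A p (\<lambda>x. \<Sum>i\<in>I. f i x)"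
  using assms(2)
  by (induction I rule: infinite_finite_induct) (auto intro: smooth_at_add smooth_at_const assms(1))

lemma smooth_at_cong:
  assumes "atlas_open A U" "p \<in> U" "\<And>x. x \<in> U \<Longrightarrow> f x = g x" "smooth_at A p f"
  shows "smooth_at A p g"
proof -
  obtain V where V: "atlas_open A V" "p \<in> V" "smooth_fun_on A V f"
    using assms(4) by (auto simp: smooth_at_def)
  have UV: "atlas_open A (U \<inter> V)" using assms(1) V(1) by (rule atlas_open_Int)
  have "smooth_fun_on A (U \<inter> V) g"
    by (rule smooth_fun_on_cong[OF UV _ smooth_fun_on_subset[OF V(3)]]) (use assms(3) in auto)
  then show ?thesis using UV V(2) assms(2) by (auto intro: smooth_atI)
qed

lemma smooth_at_differentiable:
  assumes f: "smooth_at A p f" and c: "(D, \<phi>) \<in> A" and p: "p \<in> D"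
  shows "(\<lambda>y. f (inv_into D \<phi> y)) differentiable (at (\<phi> p))"
proof -
  obtain U where U: "p \<in> U" "smooth_fun_on A U f"
    using f by (auto simp: smooth_at_def)
  show ?thesis
    by (rule smooth_on_differentiable[OF smooth_fun_onD[OF U(2) c]]) (use U p in auto)
qed

subsection \<open>Tangent vectors\<close>

lemma coordinate_vector_not_smooth:
  "(D, \<phi>) \<in> A \<Longrightarrow> p \<in> D \<Longrightarrow> \<not> smooth_at A p f \<Longrightarrow> coordinate_vector A D \<phi> p u f = 0"
  by (simp add: coordinate_vector_def velocity_def inv_chart)

text \<open>By the chain rule in the chart, a curve acts on functions only through its chart
  velocity \<open>u\<close> at time 0.\<close>

lemma velocity_eq:
  assumes c: "(D, \<phi>) \<in> A" and p: "p \<in> D" and f: "smooth_at A p f"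
    and \<gamma>: "\<gamma> 0 = p" "open I" "0 \<in> I" "\<And>s. s \<in> I \<Longrightarrow> \<gamma> s \<in> D"
    and u: "((\<lambda>s. \<phi> (\<gamma> s)) has_vector_derivative u) (at 0)"
  shows "velocity A \<gamma> f = frechet_derivative (\<lambda>y. f (inv_into D \<phi> y)) (at (\<phi> p)) u"
proof -
  let ?F = "\<lambda>y. f (inv_into D \<phi> y)"
  let ?L = "frechet_derivative ?F (at (\<phi> p))"
  have F: "(?F has_derivative ?L) (at (\<phi> (\<gamma> 0)))"
    using smooth_at_differentiable[OF f c p] \<gamma>(1) by (simp add: frechet_derivative_works[symmetric])
  have L: "linear ?L"
    using smooth_at_differentiable[OF f c p] by (rule linear_frechet_derivative)
  have "((\<lambda>s. ?F (\<phi> (\<gamma> s))) has_derivative (\<lambda>s. ?L (s *\<^sub>R u))) (at 0)"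
    using has_derivative_compose[OF u[unfolded has_vector_derivative_def] F] .
  then have "((\<lambda>s. f (\<gamma> s)) has_derivative (\<lambda>s. ?L (s *\<^sub>R u))) (at 0)"
    by (rule has_derivative_transform_within_open[OF _ \<gamma>(2,3)]) (use c \<gamma>(4) in \<open>simp add: inv_chart\<close>)
  then have "((\<lambda>s. f (\<gamma> s)) has_real_derivative ?L u) (at 0)"
    unfolding has_field_derivative_def
    by (rule has_derivative_eq_rhs) (simp add: linear_cmul[OF L] fun_eq_iff mult.commute)
  then show ?thesis
    using f \<gamma>(1) by (simp add: velocity_def o_def DERIV_imp_deriv)
qed

lemma line_in_chart:
  assumes c: "(D, \<phi>) \<in> A" and p: "p \<in> D"
  obtains \<epsilon> where "\<epsilon> > 0" "\<And>s. s \<in> {-\<epsilon><..<\<epsilon>} \<Longrightarrow> \<phi> p + s *\<^sub>R u \<in> \<phi> ` D"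
proof -
  let ?W = "(\<lambda>s::real. \<phi> p + s *\<^sub>R u) -` (\<phi> ` D)"
  have "open ?W"
    by (intro open_vimage chart_image_open[OF c] continuous_intros)
  moreover have "0 \<in> ?W" using p by simp
  ultimately obtain \<epsilon> where "\<epsilon> > 0" "ball 0 \<epsilon> \<subseteq> ?W" by (rule openE)
  then show ?thesis by (intro that[of \<epsilon>]) (auto simp: subset_eq dist_real_def)
qed

lemma coordinate_vector_apply:
  assumes c: "(D, \<phi>) \<in> A" and p: "p \<in> D" and f: "smooth_at A p f"
  shows "coordinate_vector A D \<phi> p u f = frechet_derivative (\<lambda>y. f (inv_into D \<phi> y)) (at (\<phi> p)) u"
proof -
  obtain \<epsilon> where \<epsilon>: "\<epsilon> > 0" "\<And>s. s \<in> {-\<epsilon><..<\<epsilon>} \<Longrightarrow> \<phi> p + s *\<^sub>R u \<in> \<phi> ` D"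
    using line_in_chart[OF c p] by blast
  show ?thesis
    unfolding coordinate_vector_def
  proof (rule velocity_eq[OF c p f, where I = "{-\<epsilon><..<\<epsilon>}"])
    have "((\<lambda>s. \<phi> p + s *\<^sub>R u) has_vector_derivative u) (at 0)"
      by (auto intro!: derivative_eq_intros)
    then show "((\<lambda>s. \<phi> (inv_into D \<phi> (\<phi> p + s *\<^sub>R u))) has_vector_derivative u) (at 0)"
      by (rule has_vector_derivative_transform_within_open[where S = "{-\<epsilon><..<\<epsilon>}"])
        (use \<epsilon> in \<open>auto simp: f_inv_into_f\<close>)
  qed (use \<epsilon> c p in \<open>auto simp: inv_chart intro!: inv_into_into\<close>)
qed

text \<open>Curves with the same chart velocity give the same tangent vector, and every direction is
  the chart velocity of a straight line. This parametrisation by the model space is the source of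
  all linear structure on tangent vectors.\<close>

lemma tangent_space_eq:
  assumes c: "(D, \<phi>) \<in> A" and p: "p \<in> D"
  shows "tangent_space A p = range (coordinate_vector A D \<phi> p)"
proof (intro equalityI subsetI)
  fix v assume "v \<in> tangent_space A p"
  then obtain \<gamma> \<epsilon> where v: "v = velocity A \<gamma>" "0 < \<epsilon>" "smooth_curve A {-\<epsilon><..<\<epsilon>} \<gamma>" "\<gamma> 0 = p"
    by (auto simp: tangent_space_def)
  let ?I = "{s \<in> {-\<epsilon><..<\<epsilon>}. \<gamma> s \<in> D}"
  have I: "open ?I" "0 \<in> ?I" and sm: "smooth_on ?I (\<lambda>s. \<phi> (\<gamma> s))"
    using v(2-4) c p by (auto simp: smooth_curve_def o_def)
  obtain u where u: "((\<lambda>s. \<phi> (\<gamma> s)) has_vector_derivative u) (at 0)"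
    using smooth_on_differentiable[OF sm I(2)] differentiable_def vector_derivative_works by blast
  have "velocity A \<gamma> f = coordinate_vector A D \<phi> p u f" for f
  proof (cases "smooth_at A p f")
    case True
    then show ?thesis
      using velocity_eq[OF c p True v(4) I _ u] by (simp add: coordinate_vector_apply[OF c p])
  next
    case False
    then show ?thesis
      using coordinate_vector_not_smooth[OF c p False] v(4) by (simp add: velocity_def)
  qed
  then show "v \<in> range (coordinate_vector A D \<phi> p)" using v(1) by auto
next
  fix v assume "v \<in> range (coordinate_vector A D \<phi> p)"
  then obtain u where u: "v = coordinate_vector A D \<phi> p u" by auto
  obtain \<epsilon> where \<epsilon>: "\<epsilon> > 0" "\<And>s. s \<in> {-\<epsilon><..<\<epsilon>} \<Longrightarrow> \<phi> p + s *\<^sub>R u \<in> \<phi> ` D"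
    using line_in_chart[OF c p] by blast
  let ?\<gamma> = "\<lambda>s. inv_into D \<phi> (\<phi> p + s *\<^sub>R u)"
  have "smooth_curve A {-\<epsilon><..<\<epsilon>} ?\<gamma>"
    unfolding smooth_curve_def
  proof (intro conjI ballI)
    show "?\<gamma> ` {-\<epsilon><..<\<epsilon>} \<subseteq> atlas_space A"
      using subsetD[OF chart_subset[OF c] inv_into_into[OF \<epsilon>(2)]] by (intro image_subsetI)
    fix e assume e: "e \<in> A"
    obtain E \<psi> where [simp]: "e = (E, \<psi>)" by (cases e)
    have d: "(E, \<psi>) \<in> A" using e by simp
    \<comment> \<open>Seen in the first chart, the times spent in \<open>E\<close> are the preimage
      of a transition domain under an affine map, hence an open set.\<close>
    have eq: "{s \<in> {-\<epsilon><..<\<epsilon>}. ?\<gamma> s \<in> E} =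
        {-\<epsilon><..<\<epsilon>} \<inter> (\<lambda>s. \<phi> p + s *\<^sub>R u) -` (\<phi> ` (D \<inter> E))" (is "?I = _")
    proof (intro equalityI subsetI)
      fix s assume s: "s \<in> ?I"
      then obtain x where "x \<in> D" "\<phi> p + s *\<^sub>R u = \<phi> x" using \<epsilon>(2)[of s] by auto
      then show "s \<in> {-\<epsilon><..<\<epsilon>} \<inter> (\<lambda>s. \<phi> p + s *\<^sub>R u) -` (\<phi> ` (D \<inter> E))"
        using s inv_chart[OF c] by auto
    qed (use inv_chart[OF c] in auto)
    have op: "open ?I"
      unfolding eq by (intro open_Int open_vimage transition_domain_open[OF c d] continuous_intros open_greaterThanLessThan)
    have "smooth_on ?I (\<lambda>s. \<psi> (?\<gamma> s))"
    proof (rule smooth_on_compose[OF frame op _ transition_smooth[OF c d]])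
      show "smooth_on ?I (\<lambda>s. \<phi> p + s *\<^sub>R u)"
        by (intro smooth_on_add smooth_on_scaleR smooth_on_const smooth_on_ident op)
      show "(\<lambda>s. \<phi> p + s *\<^sub>R u) ` ?I \<subseteq> \<phi> ` (D \<inter> E)" unfolding eq by auto
    qed
    then show "case e of (E, \<psi>) \<Rightarrow>
        open {s \<in> {-\<epsilon><..<\<epsilon>}. ?\<gamma> s \<in> E} \<and> smooth_on {s \<in> {-\<epsilon><..<\<epsilon>}. ?\<gamma> s \<in> E} (\<psi> \<circ> ?\<gamma>)"
      using op by (simp add: o_def)
  qed
  then show "v \<in> tangent_space A p"
    using u \<epsilon>(1) p c unfolding tangent_space_def coordinate_vector_def
    by (fastforce simp: inv_chart)
qed

lemma coordinate_vector_tangent: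
  "(D, \<phi>) \<in> A \<Longrightarrow> p \<in> D \<Longrightarrow> coordinate_vector A D \<phi> p u \<in> tangent_space A p"
  by (simp add: tangent_space_eq)

lemma tangentE:
  assumes "v \<in> tangent_space A p" "(D, \<phi>) \<in> A" "p \<in> D"
  obtains u where "v = coordinate_vector A D \<phi> p u"
  using assms tangent_space_eq by blast

lemma coordinate_vector_linear_comb:
  assumes c: "(D, \<phi>) \<in> A" and p: "p \<in> D"
  shows "coordinate_vector A D \<phi> p (a *\<^sub>R u + b *\<^sub>R w) =
    (\<lambda>f. a * coordinate_vector A D \<phi> p u f + b * coordinate_vector A D \<phi> p w f)"
proof
  fix f
  show "coordinate_vector A D \<phi> p (a *\<^sub>R u + b *\<^sub>R w) f =
    a * coordinate_vector A D \<phi> p u f + b * coordinate_vector A D \<phi> p w f"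
  proof (cases "smooth_at A p f")
    case True
    interpret L: linear "frechet_derivative (\<lambda>y. f (inv_into D \<phi> y)) (at (\<phi> p))"
      by (rule linear_frechet_derivative[OF smooth_at_differentiable[OF True c p]])
    show ?thesis
      by (simp add: coordinate_vector_apply[OF c p True] L.add L.scaleR)
  qed (simp add: coordinate_vector_not_smooth[OF c p])
qed

text \<open>The combination is formed on the chart directions, where
  \<open>coordinate_vector\<close> is linear.\<close>

lemma tangent_linear_comb:
  assumes "p \<in> atlas_space A" "v \<in> tangent_space A p" "w \<in> tangent_space A p"
  shows "(\<lambda>f. a * v f + b * w f) \<in> tangent_space A p"
proof -
  obtain D \<phi> where c: "(D, \<phi>) \<in> A" "p \<in> D" using assms(1) by (rule in_chartE)
  obtain u where u: "v = coordinate_vector A D \<phi> p u" using tangentE[OF assms(2) c] .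
  obtain u' where u': "w = coordinate_vector A D \<phi> p u'" using tangentE[OF assms(3) c] .
  show ?thesis
    unfolding u u' coordinate_vector_linear_comb[OF c, symmetric] by (rule coordinate_vector_tangent[OF c])
qed

lemma tangent_add:
  "p \<in> atlas_space A \<Longrightarrow> v \<in> tangent_space A p \<Longrightarrow> w \<in> tangent_space A p \<Longrightarrow>
    (\<lambda>f. v f + w f) \<in> tangent_space A p"
  using tangent_linear_comb[of p v w 1 1] by simp

lemma tangent_scale:
  "p \<in> atlas_space A \<Longrightarrow> v \<in> tangent_space A p \<Longrightarrow> (\<lambda>f. c * v f) \<in> tangent_space A p"
  using tangent_linear_comb[of p v v c 0] by simp

section \<open>Tangent vectors as derivations\<close>

lemma tangent_not_smooth:
  assumes "v \<in> tangent_space A p" "\<not> smooth_at A p f"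
  shows "v f = 0"
  using assms by (auto simp: tangent_space_def velocity_def)

lemma tangent_space_point: "v \<in> tangent_space A p \<Longrightarrow> p \<in> atlas_space A"
  by (force simp: tangent_space_def smooth_curve_def)

text \<open>Smoothness near \<open>p\<close> is itself a local property, so \<open>f\<close> and
  \<open>g\<close> are either both differentiated or both sent to the dummy value 0. This is what
  allows formulas valid only near \<open>p\<close> to be differentiated.\<close>

lemma tangent_cong:
  assumes v: "v \<in> tangent_space A p" and U: "atlas_open A U" "p \<in> U" and eq: "\<And>x. x \<in> U \<Longrightarrow> f x = g x"
  shows "v f = v g"
proof (cases "smooth_at A p f")
  case True
  then have g: "smooth_at A p g" using U eq by (blast intro: smooth_at_cong)
  obtain D \<phi> where c: "(D, \<phi>) \<in> A" "p \<in> D"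
    using tangent_space_point[OF v] by (rule in_chartE)
  obtain u where u: "v = coordinate_vector A D \<phi> p u" using tangentE[OF v c] .
  have "frechet_derivative (\<lambda>y. f (inv_into D \<phi> y)) (at (\<phi> p)) =
      frechet_derivative (\<lambda>y. g (inv_into D \<phi> y)) (at (\<phi> p))"
    by (rule frechet_derivative_transform_within_open[OF smooth_at_differentiable[OF True c] atlas_open_image[OF U(1) c(1)]])
      (use c U eq in \<open>auto simp: inv_chart\<close>)
  then show ?thesis by (simp add: u coordinate_vector_apply[OF c] True g)
next
  case False
  then have "\<not> smooth_at A p g" using U eq smooth_at_cong[OF U, of g f] by auto
  then show ?thesis using tangent_not_smooth[OF v] False by simp
qed

lemma tangent_fun_add:
  assumes v: "v \<in> tangent_space A p" and f: "smooth_at A p f" and g: "smooth_at A p g"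
  shows "v (\<lambda>x. f x + g x) = v f + v g"
proof -
  obtain D \<phi> where c: "(D, \<phi>) \<in> A" "p \<in> D"
    using tangent_space_point[OF v] by (rule in_chartE)
  obtain u where u: "v = coordinate_vector A D \<phi> p u" using tangentE[OF v c] .
  note f' = smooth_at_differentiable[OF f c, unfolded frechet_derivative_works]
  note g' = smooth_at_differentiable[OF g c, unfolded frechet_derivative_works]
  show ?thesis
    using frechet_derivative_at[OF has_derivative_add[OF f' g'], symmetric]
    by (simp add: u coordinate_vector_apply[OF c] f g smooth_at_add)
qed

lemma tangent_fun_mult:
  assumes v: "v \<in> tangent_space A p" and f: "smooth_at A p f" and g: "smooth_at A p g"
  shows "v (\<lambda>x. f x * g x) = f p * v g + v f * g p"
proof -
  obtain D \<phi> where c: "(D, \<phi>) \<in> A" "p \<in> D"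
    using tangent_space_point[OF v] by (rule in_chartE)
  obtain u where u: "v = coordinate_vector A D \<phi> p u" using tangentE[OF v c] .
  note f' = smooth_at_differentiable[OF f c, unfolded frechet_derivative_works]
  note g' = smooth_at_differentiable[OF g c, unfolded frechet_derivative_works]
  show ?thesis
    using frechet_derivative_at[OF has_derivative_mult[OF f' g'], symmetric]
    by (simp add: u coordinate_vector_apply[OF c] f g smooth_at_mult inv_chart[OF c])
qed

lemma tangent_fun_const:
  assumes v: "v \<in> tangent_space A p"
  shows "v (\<lambda>x. c) = 0"
proof -
  have p: "p \<in> atlas_space A" by (rule tangent_space_point[OF v])
  obtain D \<phi> where c: "(D, \<phi>) \<in> A" "p \<in> D" using p by (rule in_chartE)
  obtain u where u: "v = coordinate_vector A D \<phi> p u" using tangentE[OF v c] .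
  show ?thesis by (simp add: u coordinate_vector_apply[OF c smooth_at_const[OF p]])
qed

lemma tangent_fun_cmult:
  assumes v: "v \<in> tangent_space A p" and f: "smooth_at A p f"
  shows "v (\<lambda>x. c * f x) = c * v f"
  using tangent_fun_mult[OF v smooth_at_const[OF tangent_space_point[OF v], of c] f]
  by (simp add: tangent_fun_const[OF v])

lemma tangent_fun_diff:
  assumes v: "v \<in> tangent_space A p" and f: "smooth_at A p f" and g: "smooth_at A p g"
  shows "v (\<lambda>x. f x - g x) = v f - v g"
  using tangent_fun_add[OF v smooth_at_diff[OF f g] g] by simp

lemma tangent_fun_sum:
  assumes v: "v \<in> tangent_space A p" and "\<And>i. i \<in> I \<Longrightarrow> smooth_at A p (f i)"
  shows "v (\<lambda>x. \<Sum>i\<in>I. f i x) = (\<Sum>i\<in>I. v (f i))"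
  using assms(2)
proof (induction I rule: infinite_finite_induct)
  case (insert i I)
  then have "smooth_at A p (\<lambda>x. \<Sum>i\<in>I. f i x)"
    by (intro smooth_at_sum tangent_space_point[OF v]) auto
  then show ?case using insert by (simp add: tangent_fun_add[OF v])
qed (simp_all add: tangent_fun_const[OF v])

section \<open>Components of a tangent vector in a chart\<close>

lemma coordinate_vector_coordinate:
  assumes c: "(D, \<phi>) \<in> A" and p: "p \<in> D"
  shows "coordinate_vector A D \<phi> p u (\<lambda>x. \<phi> x \<bullet> b) = u \<bullet> b"
proof -
  have "((\<lambda>y. y \<bullet> b) has_derivative (\<lambda>u. u \<bullet> b)) (at (\<phi> p))"
    by (auto intro!: derivative_eq_intros)
  then have "((\<lambda>y. \<phi> (inv_into D \<phi> y) \<bullet> b) has_derivative (\<lambda>u. u \<bullet> b)) (at (\<phi> p))"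
    by (rule has_derivative_transform_within_open[OF _ chart_image_open[OF c]])
      (use p in \<open>auto simp: f_inv_into_f\<close>)
  from frechet_derivative_at[OF this, symmetric] show ?thesis
    by (simp add: coordinate_vector_apply[OF c p] smooth_at_coordinate[OF c p])
qed

lemma tangent_representation:
  assumes v: "v \<in> tangent_space A p" and c: "(D, \<phi>) \<in> A" and p: "p \<in> D"
  shows "v = coordinate_vector A D \<phi> p (\<Sum>b\<in>B. v (\<lambda>x. \<phi> x \<bullet> b) *\<^sub>R b)"
proof -
  obtain u where u: "v = coordinate_vector A D \<phi> p u" using tangentE[OF v c p] .
  have "(\<Sum>b\<in>B. v (\<lambda>x. \<phi> x \<bullet> b) *\<^sub>R b) = u"
    using parseval_frame_sum[OF frame] by (simp add: u coordinate_vector_coordinate[OF c p])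
  then show ?thesis using u by simp
qed

lemma tangent_apply_chart:
  assumes v: "v \<in> tangent_space A p" and c: "(D, \<phi>) \<in> A" and p: "p \<in> D" and f: "smooth_at A p f"
  shows "v f = (\<Sum>b\<in>B. v (\<lambda>x. \<phi> x \<bullet> b) * frechet_derivative (\<lambda>y. f (inv_into D \<phi> y)) (at (\<phi> p)) b)"
proof -
  obtain u where u: "v = coordinate_vector A D \<phi> p u" using tangentE[OF v c p] .
  show ?thesis
    using parseval_frame_linear[OF frame linear_frechet_derivative[OF smooth_at_differentiable[OF f c p]], of u]
    by (simp add: u coordinate_vector_coordinate[OF c p] coordinate_vector_apply[OF c p f])
qed

subsection \<open>Vector fields\<close>

lemma vf_tangent: "X \<in> vector_fields A \<Longrightarrow> p \<in> atlas_space A \<Longrightarrow> X p \<in> tangent_space A p"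
  by (simp add: vector_fields_def)

lemma vf_outside: "X \<in> vector_fields A \<Longrightarrow> p \<notin> atlas_space A \<Longrightarrow> X p f = 0"
  by (simp add: vector_fields_def)

lemma vf_not_smooth:
  assumes "X \<in> vector_fields A" "\<not> smooth_at A p f"
  shows "X p f = 0"
  using assms vf_outside vf_tangent tangent_not_smooth by blast

lemma vf_smooth:
  "X \<in> vector_fields A \<Longrightarrow> atlas_open A U \<Longrightarrow> smooth_fun_on A U f \<Longrightarrow> smooth_fun_on A U (\<lambda>p. X p f)"
  by (simp add: vector_fields_def)

lemma vf_smooth_at: "X \<in> vector_fields A \<Longrightarrow> smooth_at A p f \<Longrightarrow> smooth_at A p (\<lambda>x. X x f)"
  using vf_smooth unfolding smooth_at_def by blast

lemma vf_zero_closed: "vf_zero \<in> vector_fields A"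
proof -
  have "(\<lambda>f. 0) \<in> tangent_space A p" if p: "p \<in> atlas_space A" for p
  proof -
    obtain D \<phi> where c: "(D, \<phi>) \<in> A" "p \<in> D" using p by (rule in_chartE)
    have "(\<lambda>f. 0 * coordinate_vector A D \<phi> p 0 f) \<in> tangent_space A p"
      by (intro tangent_scale p coordinate_vector_tangent c)
    then show ?thesis by simp
  qed
  then show ?thesis
    by (simp add: vector_fields_def vf_zero_def smooth_fun_on_const)
qed

lemma vf_add_closed: "X \<in> vector_fields A \<Longrightarrow> Y \<in> vector_fields A \<Longrightarrow> vf_add X Y \<in> vector_fields A"
  using tangent_add smooth_fun_on_add
  by (auto simp: vector_fields_def vf_add_def)

lemma vf_scale_closed: "X \<in> vector_fields A \<Longrightarrow> vf_scale c X \<in> vector_fields A"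
  using tangent_scale smooth_fun_on_cmult
  by (auto simp: vector_fields_def vf_scale_def)

text \<open>The composite of two vector fields is a second-order operator. The first sum is its
  first-order part; the second pairs the components with the Hessian of \<open>F\<close> and is the
  part that cancels in a bracket.\<close>

lemma vf_vf_apply_chart:
  assumes X: "X \<in> vector_fields A" and Y: "Y \<in> vector_fields A" and f: "smooth_at A p f"
    and c: "(D, \<phi>) \<in> A" and p: "p \<in> D"
  defines "F \<equiv> \<lambda>y. f (inv_into D \<phi> y)"
  shows "X p (\<lambda>x. Y x f) =
    (\<Sum>b\<in>B. X p (\<lambda>x. Y x (\<lambda>x. \<phi> x \<bullet> b)) * frechet_derivative F (at (\<phi> p)) b) +
    (\<Sum>b\<in>B. \<Sum>d\<in>B. Y p (\<lambda>x. \<phi> x \<bullet> b) * X p (\<lambda>x. \<phi> x \<bullet> d) *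
      frechet_derivative (\<lambda>y. frechet_derivative F (at y) b) (at (\<phi> p)) d)"
proof -
  obtain V where V: "atlas_open A V" "p \<in> V" "smooth_fun_on A V f"
    using f by (auto simp: smooth_at_def)
  define U where "U = V \<inter> D"
  have U: "atlas_open A U" "p \<in> U" "U \<subseteq> D" "smooth_fun_on A U f"
    using V p atlas_open_Int[OF V(1) atlas_open_chart[OF c]] smooth_fun_on_subset[of V f U] by (auto simp: U_def)
  have UD: "U \<inter> D = U" using U(3) by auto
  have F: "smooth_on (\<phi> ` U) F" using smooth_fun_onD[OF U(4) c] by (simp add: UD F_def)
  have op: "open (\<phi> ` U)" using atlas_open_image[OF U(1) c] by (simp add: UD)
  have ps: "p \<in> atlas_space A" using c p chart_subset by blast
  note Xp = vf_tangent[OF X ps]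
  let ?d = "\<lambda>b x. frechet_derivative F (at (\<phi> x)) b"
  let ?H = "\<lambda>b d. frechet_derivative (\<lambda>y. frechet_derivative F (at y) b) (at (\<phi> p)) d"
  have d: "smooth_fun_on A U (?d b)" for b
    using smooth_fun_on_chart[OF c U(1,3) smooth_on_derivative[OF F]] .
  have Yc: "smooth_fun_on A U (\<lambda>x. Y x (\<lambda>x. \<phi> x \<bullet> b))" for b
    by (intro vf_smooth[OF Y U(1)] smooth_fun_on_subset[OF smooth_fun_on_coordinate[OF c] U(3)])
  have Xd: "X p (?d b) = (\<Sum>d\<in>B. X p (\<lambda>x. \<phi> x \<bullet> d) * ?H b d)" for b
  proof -
    have "frechet_derivative (\<lambda>y. frechet_derivative F (at y) b) (at (\<phi> p)) =
      frechet_derivative (\<lambda>y. ?d b (inv_into D \<phi> y)) (at (\<phi> p))"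
      by (rule frechet_derivative_transform_within_open[OF smooth_on_differentiable[OF smooth_on_derivative[OF F]] op])
        (use U inv_chart[OF c] in auto)
    then show ?thesis
      using tangent_apply_chart[OF Xp c p smooth_atI[OF U(1) d U(2)]] by simp
  qed
  \<comment> \<open>The chart expansion of \<open>Y x f\<close> is needed on a whole neighbourhood
    of \<open>p\<close>, because \<open>X p\<close> differentiates it.\<close>
  have "X p (\<lambda>x. Y x f) = X p (\<lambda>x. \<Sum>b\<in>B. Y x (\<lambda>x. \<phi> x \<bullet> b) * ?d b x)"
  proof (rule tangent_cong[OF Xp U(1,2)])
    fix x assume x: "x \<in> U"
    then show "Y x f = (\<Sum>b\<in>B. Y x (\<lambda>x. \<phi> x \<bullet> b) * ?d b x)"
      unfolding F_def
      using U c chart_subset[OF c] by (intro tangent_apply_chart vf_tangent[OF Y]) (auto intro: smooth_atI)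
  qed
  also have "\<dots> = (\<Sum>b\<in>B. X p (\<lambda>x. Y x (\<lambda>x. \<phi> x \<bullet> b) * ?d b x))"
    by (rule tangent_fun_sum[OF Xp], rule smooth_atI[OF U(1) smooth_fun_on_mult[OF U(1) Yc d] U(2)])
  also have "\<dots> = (\<Sum>b\<in>B. X p (\<lambda>x. Y x (\<lambda>x. \<phi> x \<bullet> b)) * ?d b p + Y p (\<lambda>x. \<phi> x \<bullet> b) * X p (?d b))"
    using tangent_fun_mult[OF Xp smooth_atI[OF U(1) Yc U(2)] smooth_atI[OF U(1) d U(2)]]
    by (simp add: add.commute)
  finally show ?thesis
    by (simp add: sum.distrib Xd sum_distrib_left mult.assoc)
qed

lemma lie_bracket_apply:
  "smooth_at A p f \<Longrightarrow> lie_bracket A X Y p f = X p (\<lambda>x. Y x f) - Y p (\<lambda>x. X x f)"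
  by (simp add: lie_bracket_def)

lemma lie_bracket_not_smooth: "\<not> smooth_at A p f \<Longrightarrow> lie_bracket A X Y p f = 0"
  by (simp add: lie_bracket_def)

text \<open>Tangency is the substantial point. The Hessian terms cancel by symmetry, and what
  remains is the coordinate vector with components \<open>?Z b\<close>, the bracket evaluated on the
  coordinate functions.\<close>

lemma lie_bracket_closed:
  assumes X: "X \<in> vector_fields A" and Y: "Y \<in> vector_fields A"
  shows "lie_bracket A X Y \<in> vector_fields A"
  unfolding vector_fields_def
proof (intro CollectI conjI ballI allI impI)
  fix p assume ps: "p \<in> atlas_space A"
  obtain D \<phi> where c: "(D, \<phi>) \<in> A" and p: "p \<in> D" using ps by (rule in_chartE)
  let ?Z = "\<lambda>b. X p (\<lambda>x. Y x (\<lambda>x. \<phi> x \<bullet> b)) - Y p (\<lambda>x. X x (\<lambda>x. \<phi> x \<bullet> b))"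
  have "lie_bracket A X Y p f = coordinate_vector A D \<phi> p (\<Sum>b\<in>B. ?Z b *\<^sub>R b) f" for f
  proof (cases "smooth_at A p f")
    case True
    define F where "F = (\<lambda>y. f (inv_into D \<phi> y))"
    interpret L: linear "frechet_derivative F (at (\<phi> p))"
      unfolding F_def by (rule linear_frechet_derivative[OF smooth_at_differentiable[OF True c p]])
    obtain V where V: "atlas_open A V" "p \<in> V" "smooth_fun_on A V f"
      using True by (auto simp: smooth_at_def)
    have sym: "frechet_derivative (\<lambda>y. frechet_derivative F (at y) b) (at (\<phi> p)) d =
      frechet_derivative (\<lambda>y. frechet_derivative F (at y) d) (at (\<phi> p)) b" for b d
      using V p unfolding F_def
      by (intro smooth_on_second_derivative_commute[OF atlas_open_image[OF V(1) c] smooth_fun_onD[OF V(3) c]]) auto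
    have "(\<Sum>b\<in>B. \<Sum>d\<in>B. Y p (\<lambda>x. \<phi> x \<bullet> b) * X p (\<lambda>x. \<phi> x \<bullet> d) *
        frechet_derivative (\<lambda>y. frechet_derivative F (at y) b) (at (\<phi> p)) d) =
      (\<Sum>b\<in>B. \<Sum>d\<in>B. X p (\<lambda>x. \<phi> x \<bullet> b) * Y p (\<lambda>x. \<phi> x \<bullet> d) *
        frechet_derivative (\<lambda>y. frechet_derivative F (at y) b) (at (\<phi> p)) d)"
      \<comment> \<open>Renaming the summation indices exchanges the roles of \<open>X\<close> and
        \<open>Y\<close>; symmetry of the Hessian restores the order of differentiation.\<close>
      by (subst sum.swap, subst sym) (simp add: mult.commute)
    then have "lie_bracket A X Y p f = (\<Sum>b\<in>B. ?Z b * frechet_derivative F (at (\<phi> p)) b)"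
      using vf_vf_apply_chart[OF X Y True c p] vf_vf_apply_chart[OF Y X True c p]
      by (simp add: lie_bracket_apply[OF True] F_def left_diff_distrib sum_subtractf)
    then show ?thesis
      unfolding coordinate_vector_apply[OF c p True] F_def[symmetric]
      by (simp add: L.sum L.scaleR)
  qed (simp add: lie_bracket_not_smooth coordinate_vector_not_smooth[OF c p])
  then have "lie_bracket A X Y p = coordinate_vector A D \<phi> p (\<Sum>b\<in>B. ?Z b *\<^sub>R b)" by auto
  then show "lie_bracket A X Y p \<in> tangent_space A p"
    using coordinate_vector_tangent[OF c p] by simp
next
  fix p assume "p \<notin> atlas_space A"
  then show "lie_bracket A X Y p = (\<lambda>f. 0)"
    using smooth_at_space lie_bracket_not_smooth by blast
next
  fix U f assume "atlas_open A U \<and> smooth_fun_on A U f"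
  then have U: "atlas_open A U" "smooth_fun_on A U f" by auto
  show "smooth_fun_on A U (\<lambda>p. lie_bracket A X Y p f)"
    by (rule smooth_fun_on_cong[OF U(1) _
        smooth_fun_on_diff[OF U(1) vf_smooth[OF X U(1) vf_smooth[OF Y U]] vf_smooth[OF Y U(1) vf_smooth[OF X U]]]])
      (simp add: lie_bracket_apply[OF smooth_atI[OF U]])
qed

text \<open>The case distinction in \<open>lie_bracket\<close> is resolved on a whole neighbourhood
  where \<open>f\<close> is smooth, so that \<open>Z p\<close> may be applied to the resulting
  difference.\<close>

lemma vf_lie_bracket_apply:
  assumes X: "X \<in> vector_fields A" and Y: "Y \<in> vector_fields A" and Z: "Z \<in> vector_fields A"
    and f: "smooth_at A p f"
  shows "Z p (\<lambda>x. lie_bracket A X Y x f) = Z p (\<lambda>x. X x (\<lambda>x. Y x f)) - Z p (\<lambda>x. Y x (\<lambda>x. X x f))"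
proof -
  note Zp = vf_tangent[OF Z smooth_at_space[OF f]]
  obtain U where U: "atlas_open A U" "p \<in> U" "smooth_fun_on A U f"
    using f by (auto simp: smooth_at_def)
  have "Z p (\<lambda>x. lie_bracket A X Y x f) = Z p (\<lambda>x. X x (\<lambda>x. Y x f) - Y x (\<lambda>x. X x f))"
    by (rule tangent_cong[OF Zp U(1,2)]) (simp add: lie_bracket_apply[OF smooth_atI[OF U(1,3)]])
  then show ?thesis
    using X Y f by (simp add: tangent_fun_diff[OF Zp] vf_smooth_at)
qed

text \<open>Where the smoothness premise fails, both fields take the dummy value 0.\<close>

lemma vf_eqI:
  assumes "X \<in> vector_fields A" "Y \<in> vector_fields A"
    and "\<And>p f. smooth_at A p f \<Longrightarrow> X p f = Y p f"
  shows "X = Y"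
  using assms vf_not_smooth by (metis ext)

section \<open>Bilinearity and Jacobi identity of the bracket\<close>

lemma vf_add_apply: "vf_add X Y p f = X p f + Y p f"
  by (simp add: vf_add_def)

lemma vf_scale_apply: "vf_scale c X p f = c * X p f"
  by (simp add: vf_scale_def)

lemma lie_bracket_add_left:
  assumes X: "X \<in> vector_fields A" and Y: "Y \<in> vector_fields A" and Z: "Z \<in> vector_fields A"
  shows "lie_bracket A (vf_add X Y) Z = vf_add (lie_bracket A X Z) (lie_bracket A Y Z)"
  using assms
  by (intro vf_eqI lie_bracket_closed vf_add_closed)
    (auto simp: vf_add_apply lie_bracket_apply tangent_fun_add[OF vf_tangent[OF Z smooth_at_space]] vf_smooth_at)

lemma lie_bracket_scale_left:
  assumes X: "X \<in> vector_fields A" and Y: "Y \<in> vector_fields A"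
  shows "lie_bracket A (vf_scale c X) Y = vf_scale c (lie_bracket A X Y)"
  using assms
  by (intro vf_eqI lie_bracket_closed vf_scale_closed)
    (auto simp: vf_scale_apply lie_bracket_apply tangent_fun_cmult[OF vf_tangent[OF Y smooth_at_space]]
      vf_smooth_at right_diff_distrib)

text \<open>Transfers the rules for the left argument to the right one.\<close>

lemma lie_bracket_anticommute: "lie_bracket A X Y = vf_scale (-1) (lie_bracket A Y X)"
  by (auto simp: lie_bracket_def vf_scale_def fun_eq_iff)

lemma lie_bracket_add_right:
  assumes X: "X \<in> vector_fields A" and Y: "Y \<in> vector_fields A" and Z: "Z \<in> vector_fields A"
  shows "lie_bracket A Z (vf_add X Y) = vf_add (lie_bracket A Z X) (lie_bracket A Z Y)"
  unfolding lie_bracket_anticommute[of Z] lie_bracket_add_left[OF assms]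
  by (simp add: vf_add_def vf_scale_def fun_eq_iff)

lemma lie_bracket_scale_right:
  assumes X: "X \<in> vector_fields A" and Y: "Y \<in> vector_fields A"
  shows "lie_bracket A Y (vf_scale c X) = vf_scale c (lie_bracket A Y X)"
  unfolding lie_bracket_anticommute[of Y] lie_bracket_scale_left[OF assms]
  by (simp add: vf_scale_def fun_eq_iff)

text \<open>On a smooth function the three double brackets expand into twelve iterated derivatives,
  which cancel in pairs.\<close>

lemma lie_bracket_jacobi:
  assumes X: "X \<in> vector_fields A" and Y: "Y \<in> vector_fields A" and Z: "Z \<in> vector_fields A"
  shows "vf_add (lie_bracket A X (lie_bracket A Y Z))
    (vf_add (lie_bracket A Y (lie_bracket A Z X)) (lie_bracket A Z (lie_bracket A X Y))) = vf_zero"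
  using assms
  by (intro vf_eqI lie_bracket_closed vf_add_closed vf_zero_closed)
    (auto simp: vf_add_apply vf_zero_def lie_bracket_apply vf_smooth_at vf_lie_bracket_apply)

end

subsection \<open>Conformal symmetries of a 1-form\<close>

text \<open>A one-form is a total function here, so linearity is demanded on tangent spaces only,
  and smoothness is tested by pairing with vector fields.\<close>

locale smooth_one_form = smooth_atlas_frame A B
  for A :: "('a, 'e::real_inner) atlas" and B +
  fixes \<omega> :: "'a one_form"
  assumes form_add: "v \<in> tangent_space A p \<Longrightarrow> w \<in> tangent_space A p \<Longrightarrow> \<omega> p (\<lambda>f. v f + w f) = \<omega> p v + \<omega> p w"
    and form_scale: "v \<in> tangent_space A p \<Longrightarrow> \<omega> p (\<lambda>f. c * v f) = c * \<omega> p v"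
    and form_smooth: "X \<in> vector_fields A \<Longrightarrow> smooth_fun_on A (atlas_space A) (\<lambda>p. \<omega> p (X p))"
begin

text \<open>The condition has the same shape as \<open>generalized_noether_symmetries\<close>, so
  that the two sets agree by unfolding once \<omega> is the extended form.\<close>

definition conformal_symmetries :: "('a \<Rightarrow> 'a tangent) set" where
  "conformal_symmetries = {Y \<in> vector_fields A. \<exists>\<mu>. smooth_fun_on A (atlas_space A) \<mu> \<and>
     (\<forall>X\<in>vector_fields A. \<forall>p\<in>atlas_space A. lie_derivative A Y \<omega> X p = \<mu> p * \<omega> p (X p))}"

lemma form_smooth_at:
  "X \<in> vector_fields A \<Longrightarrow> p \<in> atlas_space A \<Longrightarrow> smooth_at A p (\<lambda>x. \<omega> x (X x))"
  by (rule smooth_atI[OF atlas_open_space form_smooth])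

lemma form_vf_add:
  "X \<in> vector_fields A \<Longrightarrow> Y \<in> vector_fields A \<Longrightarrow> p \<in> atlas_space A \<Longrightarrow>
    \<omega> p (vf_add X Y p) = \<omega> p (X p) + \<omega> p (Y p)"
  by (simp add: vf_add_def form_add vf_tangent)

lemma form_vf_scale:
  "X \<in> vector_fields A \<Longrightarrow> p \<in> atlas_space A \<Longrightarrow> \<omega> p (vf_scale c X p) = c * \<omega> p (X p)"
  by (simp add: vf_scale_def form_scale vf_tangent)

lemma form_vf_zero: "p \<in> atlas_space A \<Longrightarrow> \<omega> p (vf_zero p) = 0"
  using form_vf_scale[OF vf_zero_closed, of p 0] by (simp add: vf_scale_def vf_zero_def)

text \<open>With the bracket term moved to the right, the condition becomes a formula for the
  derivative of a pairing, the form in which it is iterated.\<close>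

lemma conformal_symmetriesI:
  assumes "Y \<in> vector_fields A" "smooth_fun_on A (atlas_space A) \<mu>"
    and "\<And>X p. X \<in> vector_fields A \<Longrightarrow> p \<in> atlas_space A \<Longrightarrow>
      Y p (\<lambda>x. \<omega> x (X x)) = \<mu> p * \<omega> p (X p) + \<omega> p (lie_bracket A Y X p)"
  shows "Y \<in> conformal_symmetries"
  using assms by (auto simp: conformal_symmetries_def lie_derivative_def intro!: exI[of _ \<mu>])

lemma conformal_symmetriesE:
  assumes "Y \<in> conformal_symmetries"
  obtains \<mu> where "Y \<in> vector_fields A" "smooth_fun_on A (atlas_space A) \<mu>"
    "\<And>X p. X \<in> vector_fields A \<Longrightarrow> p \<in> atlas_space A \<Longrightarrow>
      Y p (\<lambda>x. \<omega> x (X x)) = \<mu> p * \<omega> p (X p) + \<omega> p (lie_bracket A Y X p)"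
  using assms by (force simp: conformal_symmetries_def lie_derivative_def algebra_simps)

lemma conformal_symmetries_zero: "vf_zero \<in> conformal_symmetries"
proof (rule conformal_symmetriesI[OF vf_zero_closed smooth_fun_on_const[OF atlas_open_space, of 0]])
  fix X p assume X: "X \<in> vector_fields A" and p: "p \<in> atlas_space A"
  have "lie_bracket A vf_zero X p = vf_zero p"
    using tangent_fun_const[OF vf_tangent[OF X p]] by (auto simp: lie_bracket_def vf_zero_def)
  then show "vf_zero p (\<lambda>x. \<omega> x (X x)) = 0 * \<omega> p (X p) + \<omega> p (lie_bracket A vf_zero X p)"
    using p by (simp add: form_vf_zero) (simp add: vf_zero_def)
qed

lemma conformal_symmetries_add:
  assumes "Y \<in> conformal_symmetries" "Z \<in> conformal_symmetries"
  shows "vf_add Y Z \<in> conformal_symmetries"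
proof -
  obtain \<mu> where Y: "Y \<in> vector_fields A" "smooth_fun_on A (atlas_space A) \<mu>"
    and Y': "\<And>X p. X \<in> vector_fields A \<Longrightarrow> p \<in> atlas_space A \<Longrightarrow>
      Y p (\<lambda>x. \<omega> x (X x)) = \<mu> p * \<omega> p (X p) + \<omega> p (lie_bracket A Y X p)"
    using conformal_symmetriesE[OF assms(1)] by metis
  obtain \<nu> where Z: "Z \<in> vector_fields A" "smooth_fun_on A (atlas_space A) \<nu>"
    and Z': "\<And>X p. X \<in> vector_fields A \<Longrightarrow> p \<in> atlas_space A \<Longrightarrow>
      Z p (\<lambda>x. \<omega> x (X x)) = \<nu> p * \<omega> p (X p) + \<omega> p (lie_bracket A Z X p)"
    using conformal_symmetriesE[OF assms(2)] by metis
  show ?thesis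
    by (rule conformal_symmetriesI[OF vf_add_closed[OF Y(1) Z(1)] smooth_fun_on_add[OF atlas_open_space Y(2) Z(2)]])
      (use Y Z in \<open>simp add: lie_bracket_add_left form_vf_add lie_bracket_closed vf_add_apply Y' Z' algebra_simps\<close>)
qed

lemma conformal_symmetries_scale:
  assumes "Y \<in> conformal_symmetries"
  shows "vf_scale c Y \<in> conformal_symmetries"
proof -
  obtain \<mu> where Y: "Y \<in> vector_fields A" "smooth_fun_on A (atlas_space A) \<mu>"
    and Y': "\<And>X p. X \<in> vector_fields A \<Longrightarrow> p \<in> atlas_space A \<Longrightarrow>
      Y p (\<lambda>x. \<omega> x (X x)) = \<mu> p * \<omega> p (X p) + \<omega> p (lie_bracket A Y X p)"
    using conformal_symmetriesE[OF assms(1)] by metis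
  show ?thesis
    by (rule conformal_symmetriesI[OF vf_scale_closed[OF Y(1)] smooth_fun_on_cmult[OF atlas_open_space Y(2), of c]])
      (use Y in \<open>simp add: lie_bracket_scale_left form_vf_scale lie_bracket_closed vf_scale_apply Y' algebra_simps\<close>)
qed

text \<open>Subtracting the two instances of \<open>twice\<close> removes the product \<mu> \<nu>
  \<omega>(X) and the mixed terms \<mu> \<omega>([Z, X]) and \<nu> \<omega>([Y, X]). The derivatives
  of the factors remain, together with \<omega>([Y, [Z, X]]) - \<omega>([Z, [Y, X]]).\<close>

lemma conformal_symmetries_lie_bracket:
  assumes "Y \<in> conformal_symmetries" "Z \<in> conformal_symmetries"
  shows "lie_bracket A Y Z \<in> conformal_symmetries"
proof -
  obtain \<mu> where Y: "Y \<in> vector_fields A" "smooth_fun_on A (atlas_space A) \<mu>"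
    and Y': "\<And>X p. X \<in> vector_fields A \<Longrightarrow> p \<in> atlas_space A \<Longrightarrow>
      Y p (\<lambda>x. \<omega> x (X x)) = \<mu> p * \<omega> p (X p) + \<omega> p (lie_bracket A Y X p)"
    using conformal_symmetriesE[OF assms(1)] by metis
  obtain \<nu> where Z: "Z \<in> vector_fields A" "smooth_fun_on A (atlas_space A) \<nu>"
    and Z': "\<And>X p. X \<in> vector_fields A \<Longrightarrow> p \<in> atlas_space A \<Longrightarrow>
      Z p (\<lambda>x. \<omega> x (X x)) = \<nu> p * \<omega> p (X p) + \<omega> p (lie_bracket A Z X p)"
    using conformal_symmetriesE[OF assms(2)] by metis
  \<comment> \<open>Quantified over the fields and their factors, because it is used in both
    orders.\<close>
  have twice: "Y p (\<lambda>x. Z x (\<lambda>x. \<omega> x (X x))) =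
      Y p \<nu> * \<omega> p (X p) + \<nu> p * (\<mu> p * \<omega> p (X p) + \<omega> p (lie_bracket A Y X p)) +
      \<mu> p * \<omega> p (lie_bracket A Z X p) + \<omega> p (lie_bracket A Y (lie_bracket A Z X) p)"
    if Y: "Y \<in> vector_fields A"
      and Y': "\<And>X p. X \<in> vector_fields A \<Longrightarrow> p \<in> atlas_space A \<Longrightarrow>
        Y p (\<lambda>x. \<omega> x (X x)) = \<mu> p * \<omega> p (X p) + \<omega> p (lie_bracket A Y X p)"
      and Z: "Z \<in> vector_fields A" "smooth_fun_on A (atlas_space A) \<nu>"
      and Z': "\<And>X p. X \<in> vector_fields A \<Longrightarrow> p \<in> atlas_space A \<Longrightarrow>
        Z p (\<lambda>x. \<omega> x (X x)) = \<nu> p * \<omega> p (X p) + \<omega> p (lie_bracket A Z X p)"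
      and X: "X \<in> vector_fields A" and p: "p \<in> atlas_space A" for X Y Z p \<mu> \<nu>
  proof -
    note Yp = vf_tangent[OF Y p]
    note ZX = lie_bracket_closed[OF Z(1) X]
    have sm: "smooth_at A p \<nu>" using atlas_open_space Z(2) p by (rule smooth_atI)
    have "Y p (\<lambda>x. Z x (\<lambda>x. \<omega> x (X x))) = Y p (\<lambda>x. \<nu> x * \<omega> x (X x) + \<omega> x (lie_bracket A Z X x))"
      by (rule tangent_cong[OF Yp atlas_open_space p]) (rule Z'[OF X])
    also have "\<dots> = \<nu> p * Y p (\<lambda>x. \<omega> x (X x)) + Y p \<nu> * \<omega> p (X p) + Y p (\<lambda>x. \<omega> x (lie_bracket A Z X x))"
      by (simp add: tangent_fun_add[OF Yp] tangent_fun_mult[OF Yp] smooth_at_mult sm form_smooth_at X p ZX)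
    finally show ?thesis by (simp add: Y'[OF X p] Y'[OF ZX p] algebra_simps)
  qed
  show ?thesis
  proof (rule conformal_symmetriesI[OF lie_bracket_closed[OF Y(1) Z(1)]
        smooth_fun_on_diff[OF atlas_open_space vf_smooth[OF Y(1) atlas_open_space Z(2)]
          vf_smooth[OF Z(1) atlas_open_space Y(2)]]])
    fix X p assume X: "X \<in> vector_fields A" and p: "p \<in> atlas_space A"
    \<comment> \<open>The Jacobi identity as a commutator rule: bracketing with [Y, Z] is the
      commutator of bracketing with Y and with Z.\<close>
    have jac: "lie_bracket A (lie_bracket A Y Z) X =
      vf_add (lie_bracket A Y (lie_bracket A Z X)) (vf_scale (-1) (lie_bracket A Z (lie_bracket A Y X)))"
      using X Y Z
      by (intro vf_eqI lie_bracket_closed vf_add_closed vf_scale_closed)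
        (auto simp: vf_add_apply vf_scale_apply lie_bracket_apply vf_smooth_at vf_lie_bracket_apply)
    have "\<omega> p (lie_bracket A (lie_bracket A Y Z) X p) =
      \<omega> p (lie_bracket A Y (lie_bracket A Z X) p) - \<omega> p (lie_bracket A Z (lie_bracket A Y X) p)"
      unfolding jac using X Y Z p by (simp add: form_vf_add form_vf_scale lie_bracket_closed vf_scale_closed)
    then show "lie_bracket A Y Z p (\<lambda>x. \<omega> x (X x)) =
      (Y p \<nu> - Z p \<mu>) * \<omega> p (X p) + \<omega> p (lie_bracket A (lie_bracket A Y Z) X p)"
      using twice[OF Y(1) Y' Z Z' X p] twice[OF Z(1) Z' Y Y' X p]
      by (simp add: lie_bracket_apply form_smooth_at X p algebra_simps)
  qed
qed

theorem conformal_symmetries_lie_algebra: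
  "real_lie_algebra conformal_symmetries vf_add vf_zero vf_scale (lie_bracket A)"
proof
  have vf: "x \<in> vector_fields A" if "x \<in> conformal_symmetries" for x
    using that by (simp add: conformal_symmetries_def)
  fix x y z :: "'a \<Rightarrow> 'a tangent" and a b :: real
  assume x: "x \<in> conformal_symmetries"
  show "\<exists>y\<in>conformal_symmetries. vf_add x y = vf_zero"
    by (rule bexI[OF _ conformal_symmetries_scale[OF x, of "-1"]])
      (simp add: vf_add_def vf_scale_def vf_zero_def)
  show "lie_bracket A x x = vf_zero"
    by (simp add: lie_bracket_def vf_zero_def fun_eq_iff)
  show "vf_scale a (vf_scale b x) = vf_scale (a * b) x" "vf_scale (a + b) x = vf_add (vf_scale a x) (vf_scale b x)"
    "vf_scale 1 x = x" "vf_add vf_zero x = x" "vf_scale a x \<in> conformal_symmetries"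
    using conformal_symmetries_scale[OF x] by (auto simp: vf_scale_def vf_add_def vf_zero_def algebra_simps)
  assume y: "y \<in> conformal_symmetries"
  show "vf_add x y = vf_add y x" "vf_scale a (vf_add x y) = vf_add (vf_scale a x) (vf_scale a y)"
    by (auto simp: vf_scale_def vf_add_def algebra_simps)
  show "vf_add x y \<in> conformal_symmetries" "lie_bracket A x y \<in> conformal_symmetries"
    using x y conformal_symmetries_add conformal_symmetries_lie_bracket by auto
  show "lie_bracket A (vf_scale a x) y = vf_scale a (lie_bracket A x y)"
    "lie_bracket A x (vf_scale a y) = vf_scale a (lie_bracket A x y)"
    using x y vf lie_bracket_scale_left lie_bracket_scale_right by auto
  assume z: "z \<in> conformal_symmetries"
  show "vf_add (vf_add x y) z = vf_add x (vf_add y z)"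
    by (auto simp: vf_add_def algebra_simps)
  show "lie_bracket A (vf_add x y) z = vf_add (lie_bracket A x z) (lie_bracket A y z)"
    "lie_bracket A x (vf_add y z) = vf_add (lie_bracket A x y) (lie_bracket A x z)"
    "vf_add (lie_bracket A x (lie_bracket A y z))
      (vf_add (lie_bracket A y (lie_bracket A z x)) (lie_bracket A z (lie_bracket A x y))) = vf_zero"
    using x y z vf lie_bracket_add_left lie_bracket_add_right lie_bracket_jacobi by auto
qed (rule conformal_symmetries_zero)

end

subsection \<open>Projections that are linear in suitable charts\<close>

lemma (in smooth_atlas_frame) atlas_open_in_chart:
  assumes c: "(D, \<phi>) \<in> A" and V: "V \<subseteq> D" "open (\<phi> ` V)"
  shows "atlas_open A V"
  unfolding atlas_open_def
proof (intro conjI ballI)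
  show "V \<subseteq> atlas_space A" using V(1) chart_subset[OF c] by blast
  fix e assume e: "e \<in> A"
  obtain E \<psi> where [simp]: "e = (E, \<psi>)" by (cases e)
  have d: "(E, \<psi>) \<in> A" using e by simp
  let ?t = "\<lambda>y. \<phi> (inv_into E \<psi> y)"
  have "\<psi> ` (V \<inter> E) = ?t -` (\<phi> ` V) \<inter> \<psi> ` (E \<inter> D)"
  proof (intro equalityI subsetI)
    fix y assume "y \<in> ?t -` (\<phi> ` V) \<inter> \<psi> ` (E \<inter> D)"
    then obtain x z where xz: "x \<in> E" "x \<in> D" "y = \<psi> x" "z \<in> V" "?t y = \<phi> z" by auto
    then have "\<phi> x = \<phi> z" by (simp add: inv_chart[OF d])
    then have "x = z" using chart_inj[OF c] V(1) xz by (auto simp: inj_on_def)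
    then show "y \<in> \<psi> ` (V \<inter> E)" using xz by auto
  qed (use V(1) inv_chart[OF d] in auto)
  then show "case e of (E, \<psi>) \<Rightarrow> open (\<psi> ` (V \<inter> E))"
    using smooth_on_continuous_on[OF transition_smooth[OF d c]] V(2)
    by (simp add: continuous_on_open_vimage[OF transition_domain_open[OF d c]])
qed

text \<open>A common frame for T*Q -> Q and N x R -> N. As \<open>L\<close> is its own derivative,
  \<open>F\<close> pushes the coordinate vector of \<open>u\<close> to that of
  \<open>L u\<close>.\<close>

locale chart_projection = M: smooth_atlas_frame A B + N: smooth_atlas_frame A' B'
  for A :: "('a, 'e::real_inner) atlas" and B and A' :: "('b, 'f::real_inner) atlas" and B' +
  fixes F :: "'a \<Rightarrow> 'b" and L :: "'e \<Rightarrow> 'f"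
  assumes bounded_linear: "bounded_linear L"
    and projected_chart: "(C, \<Phi>) \<in> A \<Longrightarrow> \<exists>D \<phi>. (D, \<phi>) \<in> A' \<and> F ` C \<subseteq> D \<and> (\<forall>x\<in>C. \<phi> (F x) = L (\<Phi> x))"
begin

lemma projected_chartE:
  assumes "p \<in> atlas_space A"
  obtains C \<Phi> D \<phi> where "(C, \<Phi>) \<in> A" "p \<in> C" "(D, \<phi>) \<in> A'"
    "\<And>x. x \<in> C \<Longrightarrow> F x \<in> D" "\<And>x. x \<in> C \<Longrightarrow> \<phi> (F x) = L (\<Phi> x)"
proof -
  obtain C \<Phi> where c: "(C, \<Phi>) \<in> A" "p \<in> C" using assms by (rule M.in_chartE)
  then show ?thesis using projected_chart[OF c(1)] that by blast
qed

lemma smooth_at_compose: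
  assumes p: "p \<in> atlas_space A" and f: "smooth_at A' (F p) f"
  shows "smooth_at A p (\<lambda>x. f (F x))"
proof -
  obtain C \<Phi> D \<phi> where c: "(C, \<Phi>) \<in> A" "p \<in> C" and d: "(D, \<phi>) \<in> A'"
    and F: "\<And>x. x \<in> C \<Longrightarrow> F x \<in> D" "\<And>x. x \<in> C \<Longrightarrow> \<phi> (F x) = L (\<Phi> x)"
    using projected_chartE[OF p] by metis
  obtain U where U: "atlas_open A' U" "F p \<in> U" "smooth_fun_on A' U f"
    using f by (auto simp: smooth_at_def)
  \<comment> \<open>The preimage of \<open>U\<close> is cut down to one chart, where it is described
    by \<open>L\<close> alone and is therefore open.\<close>
  let ?V = "{x \<in> C. F x \<in> U}"
  have "\<Phi> ` ?V = \<Phi> ` C \<inter> L -` (\<phi> ` (U \<inter> D))"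
  proof (intro equalityI subsetI)
    fix y assume "y \<in> \<Phi> ` C \<inter> L -` (\<phi> ` (U \<inter> D))"
    then obtain x z where xz: "x \<in> C" "y = \<Phi> x" "z \<in> U" "z \<in> D" "L y = \<phi> z" by auto
    then have "F x = z" using F N.chart_inj[OF d] by (auto simp: inj_on_def)
    then show "y \<in> \<Phi> ` ?V" using xz by auto
  next
    fix y assume "y \<in> \<Phi> ` ?V"
    then obtain x where x: "x \<in> C" "F x \<in> U" "y = \<Phi> x" by auto
    then show "y \<in> \<Phi> ` C \<inter> L -` (\<phi> ` (U \<inter> D))"
      using F(1)[OF x(1)] F(2)[OF x(1), symmetric] by auto
  qed
  moreover have "continuous_on UNIV L"
    using bounded_linear by (simp add: linear_continuous_on)
  ultimately have op: "open (\<Phi> ` ?V)"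
    by (simp add: open_Int M.chart_image_open[OF c(1)] open_vimage N.atlas_open_image[OF U(1) d])
  have V: "atlas_open A ?V" by (rule M.atlas_open_in_chart[OF c(1) _ op]) auto
  have "smooth_on (\<Phi> ` ?V) (\<lambda>y. f (inv_into D \<phi> (L y)))"
  proof (rule smooth_on_compose[OF N.frame op _ N.smooth_fun_onD[OF U(3) d]])
    show "smooth_on (\<Phi> ` ?V) L" by (rule smooth_on_linear[OF op bounded_linear smooth_on_ident[OF op]])
    show "L ` \<Phi> ` ?V \<subseteq> \<phi> ` (U \<inter> D)" using F F(2)[symmetric] by auto
  qed
  then have "smooth_fun_on A ?V (\<lambda>x. f (inv_into D \<phi> (L (\<Phi> x))))"
    by (intro M.smooth_fun_on_chart[OF c(1) V]) auto
  then have "smooth_fun_on A ?V (\<lambda>x. f (F x))"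
    by (rule M.smooth_fun_on_cong[OF V, rotated]) (simp add: F(2)[symmetric] N.inv_chart[OF d F(1)])
  then show ?thesis using c U by (intro M.smooth_atI[OF V]) auto
qed

lemma pushforward_apply: "smooth_at A' (F p) f \<Longrightarrow> pushforward A' F p v f = v (\<lambda>x. f (F x))"
  by (simp add: pushforward_def o_def)

text \<open>The pushforward is defined by its action on functions; that it is again a velocity
  follows from the chain rule in the two charts, with direction \<open>L u\<close>.\<close>

lemma pushforward_tangent:
  assumes v: "v \<in> tangent_space A p"
  shows "pushforward A' F p v \<in> tangent_space A' (F p)"
proof -
  have p: "p \<in> atlas_space A" by (rule M.tangent_space_point[OF v])
  obtain C \<Phi> D \<phi> where c: "(C, \<Phi>) \<in> A" "p \<in> C" and d: "(D, \<phi>) \<in> A'"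
    and F: "\<And>x. x \<in> C \<Longrightarrow> F x \<in> D" "\<And>x. x \<in> C \<Longrightarrow> \<phi> (F x) = L (\<Phi> x)"
    using projected_chartE[OF p] by metis
  obtain u where u: "v = coordinate_vector A C \<Phi> p u" using M.tangentE[OF v c] .
  have "pushforward A' F p v f = coordinate_vector A' D \<phi> (F p) (L u) f" for f
  proof (cases "smooth_at A' (F p) f")
    case True
    have "((\<lambda>y. f (inv_into D \<phi> y)) has_derivative
        frechet_derivative (\<lambda>y. f (inv_into D \<phi> y)) (at (\<phi> (F p)))) (at (L (\<Phi> p)))"
      using N.smooth_at_differentiable[OF True d F(1)[OF c(2)]]
      by (simp add: F(2)[OF c(2)] frechet_derivative_works[symmetric])
    from has_derivative_compose[OF bounded_linear_imp_has_derivative[OF bounded_linear] this]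
    have "((\<lambda>y. f (inv_into D \<phi> (L y))) has_derivative
        (\<lambda>u. frechet_derivative (\<lambda>y. f (inv_into D \<phi> y)) (at (\<phi> (F p))) (L u))) (at (\<Phi> p))" .
    then have "((\<lambda>y. f (F (inv_into C \<Phi> y))) has_derivative
        (\<lambda>u. frechet_derivative (\<lambda>y. f (inv_into D \<phi> y)) (at (\<phi> (F p))) (L u))) (at (\<Phi> p))"
      by (rule has_derivative_transform_within_open[OF _ M.chart_image_open[OF c(1)]])
        (use c in \<open>auto simp: F(2)[symmetric] N.inv_chart[OF d F(1)] M.inv_chart[OF c(1)]\<close>)
    from frechet_derivative_at[OF this, symmetric] show ?thesis
      by (simp add: pushforward_apply[OF True] u M.coordinate_vector_apply[OF c smooth_at_compose[OF p True]]
          N.coordinate_vector_apply[OF d F(1)[OF c(2)] True])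
  next
    case False
    then show ?thesis
      by (simp add: pushforward_def N.coordinate_vector_not_smooth[OF d F(1)[OF c(2)]])
  qed
  then have "pushforward A' F p v = coordinate_vector A' D \<phi> (F p) (L u)" by auto
  then show ?thesis using N.coordinate_vector_tangent[OF d F(1)[OF c(2)]] by simp
qed

end

lemma pushforward_add: "pushforward A' F p (\<lambda>f. v f + w f) = (\<lambda>f. pushforward A' F p v f + pushforward A' F p w f)"
  by (simp add: pushforward_def fun_eq_iff)

lemma pushforward_scale: "pushforward A' F p (\<lambda>f. c * v f) = (\<lambda>f. c * pushforward A' F p v f)"
  by (simp add: pushforward_def fun_eq_iff)

subsection \<open>Product atlases\<close>

lemma inv_into_eq: "inj_on \<phi> D \<Longrightarrow> x \<in> D \<Longrightarrow> \<phi> x = y \<Longrightarrow> inv_into D \<phi> y = x"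
  by (metis inv_into_f_f)

text \<open>Transition maps of a product are products of transition maps, each composed with a
  linear projection.\<close>

lemma smooth_atlas_frame_prod:
  assumes "smooth_atlas_frame A B" "smooth_atlas_frame A' B'"
  shows "smooth_atlas_frame (prod_atlas A A') ((\<lambda>b. (b, 0)) ` B \<union> Pair 0 ` B')"
proof
  interpret M: smooth_atlas_frame A B by fact
  interpret N: smooth_atlas_frame A' B' by fact
  show "parseval_frame ((\<lambda>b. (b, 0)) ` B \<union> Pair 0 ` B')"
    by (rule parseval_frame_prod[OF M.frame N.frame])
  have inj: "inj_on (map_prod \<phi> \<psi>) (D \<times> E)" if "(D, \<phi>) \<in> A" "(E, \<psi>) \<in> A'" for D \<phi> E \<psi>
    using M.chart_inj[OF that(1)] N.chart_inj[OF that(2)] by (rule map_prod_inj_on)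
  have img: "map_prod \<phi> \<psi> ` (D \<times> E) = \<phi> ` D \<times> \<psi> ` E" for \<phi> \<psi> D E
    by (rule map_prod_surj_on) simp_all
  have trans: "open (map_prod \<phi> \<psi> ` ((D \<times> E) \<inter> (D' \<times> E'))) \<and>
      smooth_on (map_prod \<phi> \<psi> ` ((D \<times> E) \<inter> (D' \<times> E'))) (map_prod \<phi>' \<psi>' \<circ> inv_into (D \<times> E) (map_prod \<phi> \<psi>))"
    if c: "(D, \<phi>) \<in> A" "(E, \<psi>) \<in> A'" and d: "(D', \<phi>') \<in> A" "(E', \<psi>') \<in> A'" for D \<phi> E \<psi> D' \<phi>' E' \<psi>'
  proof
    let ?S = "map_prod \<phi> \<psi> ` ((D \<times> E) \<inter> (D' \<times> E'))"
    have S: "?S = \<phi> ` (D \<inter> D') \<times> \<psi> ` (E \<inter> E')" by (simp add: Times_Int_Times img)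
    show op: "open ?S"
      unfolding S by (intro open_Times M.transition_domain_open[OF c(1) d(1)] N.transition_domain_open[OF c(2) d(2)])
    have fs: "smooth_on ?S fst" "smooth_on ?S snd"
      by (rule smooth_on_linear[OF op bounded_linear_fst smooth_on_ident[OF op]],
          rule smooth_on_linear[OF op bounded_linear_snd smooth_on_ident[OF op]])
    have "smooth_on ?S (\<lambda>y. (\<phi>' (inv_into D \<phi> (fst y)), \<psi>' (inv_into E \<psi> (snd y))))"
    proof (rule smooth_on_Pair[OF op])
      show "smooth_on ?S (\<lambda>y. \<phi>' (inv_into D \<phi> (fst y)))"
        by (rule smooth_on_compose[OF M.frame op fs(1) M.transition_smooth[OF c(1) d(1)]]) (auto simp: S)
      show "smooth_on ?S (\<lambda>y. \<psi>' (inv_into E \<psi> (snd y)))"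
        by (rule smooth_on_compose[OF N.frame op fs(2) N.transition_smooth[OF c(2) d(2)]]) (auto simp: S)
    qed
    then show "smooth_on ?S (map_prod \<phi>' \<psi>' \<circ> inv_into (D \<times> E) (map_prod \<phi> \<psi>))"
    proof (rule smooth_on_cong[OF op, rotated])
      fix y assume "y \<in> ?S"
      then obtain a b where ab: "a \<in> D" "b \<in> E" "y = (\<phi> a, \<psi> b)" by auto
      have "inv_into (D \<times> E) (map_prod \<phi> \<psi>) y = (a, b)"
        by (rule inv_into_eq[OF inj[OF c]]) (use ab in auto)
      then show "(\<phi>' (inv_into D \<phi> (fst y)), \<psi>' (inv_into E \<psi> (snd y))) =
          (map_prod \<phi>' \<psi>' \<circ> inv_into (D \<times> E) (map_prod \<phi> \<psi>)) y"
        using ab by (simp add: M.inv_chart[OF c(1)] N.inv_chart[OF c(2)])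
    qed
  qed
  have op: "open (map_prod \<phi> \<psi> ` (D \<times> E))" if "(D, \<phi>) \<in> A" "(E, \<psi>) \<in> A'" for D \<phi> E \<psi>
    unfolding img by (intro open_Times M.chart_image_open N.chart_image_open that)
  show "smooth_atlas (prod_atlas A A')"
    unfolding smooth_atlas_def
  proof (intro conjI ballI)
    fix e assume "e \<in> prod_atlas A A'"
    then obtain D \<phi> E \<psi> where e: "e = (D \<times> E, map_prod \<phi> \<psi>)" "(D, \<phi>) \<in> A" "(E, \<psi>) \<in> A'"
      by (auto simp: prod_atlas_def)
    show "case e of (D, \<phi>) \<Rightarrow> inj_on \<phi> D \<and> open (\<phi> ` D)"
      using inj[OF e(2,3)] op[OF e(2,3)] by (simp add: e(1))
    show "case e of (D, \<phi>) \<Rightarrow> \<forall>(E, \<psi>)\<in>prod_atlas A A'.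
        open (\<phi> ` (D \<inter> E)) \<and> smooth_on (\<phi> ` (D \<inter> E)) (\<psi> \<circ> inv_into D \<phi>)"
      unfolding e(1) prod.case
    proof
      fix e' assume "e' \<in> prod_atlas A A'"
      then obtain D' \<phi>' E' \<psi>' where e': "e' = (D' \<times> E', map_prod \<phi>' \<psi>')" "(D', \<phi>') \<in> A" "(E', \<psi>') \<in> A'"
        by (auto simp: prod_atlas_def)
      show "case e' of (X, g) \<Rightarrow> open (map_prod \<phi> \<psi> ` (D \<times> E \<inter> X)) \<and>
          smooth_on (map_prod \<phi> \<psi> ` (D \<times> E \<inter> X)) (g \<circ> inv_into (D \<times> E) (map_prod \<phi> \<psi>))"
        unfolding e'(1) prod.case by (rule trans[OF e(2,3) e'(2,3)])
    qed
  qed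
qed

lemma smooth_atlas_frame_real: "smooth_atlas_frame real_atlas {1}"
proof
  show "smooth_atlas real_atlas"
    using smooth_on_ident[of UNIV] by (simp add: smooth_atlas_def real_atlas_def o_def inv_id id_def)
qed (rule parseval_frame_real)

lemma chart_projection_fst:
  assumes "smooth_atlas_frame A B" "smooth_atlas_frame A' B'"
  shows "chart_projection (prod_atlas A A') ((\<lambda>b. (b, 0)) ` B \<union> Pair 0 ` B') A B fst fst"
proof (intro chart_projection.intro chart_projection_axioms.intro smooth_atlas_frame_prod assms bounded_linear_fst)
  fix C \<Phi> assume "(C, \<Phi>) \<in> prod_atlas A A'"
  then obtain D \<phi> E \<psi> where "C = D \<times> E" "\<Phi> = map_prod \<phi> \<psi>" "(D, \<phi>) \<in> A"
    by (auto simp: prod_atlas_def)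
  then show "\<exists>D \<phi>. (D, \<phi>) \<in> A \<and> fst ` C \<subseteq> D \<and> (\<forall>x\<in>C. \<phi> (fst x) = fst (\<Phi> x))"
    by (intro exI[of _ D] exI[of _ \<phi>]) auto
qed

lemma in_prod_atlas:
  "(D, \<phi>) \<in> A \<Longrightarrow> (E, \<psi>) \<in> A' \<Longrightarrow> (D \<times> E, map_prod \<phi> \<psi>) \<in> prod_atlas A A'"
  by (auto simp: prod_atlas_def)

lemma in_cotangent_bundle:
  "(D, \<phi>) \<in> A \<Longrightarrow>
    (Sigma D (cotangent_space A), \<lambda>(q, \<xi>). (\<phi> q, momentum A D \<phi> q \<xi>)) \<in> cotangent_bundle A"
  unfolding cotangent_bundle_def by blast

lemma in_atlas_space: "(D, \<phi>) \<in> A \<Longrightarrow> x \<in> D \<Longrightarrow> x \<in> atlas_space A"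
  by (auto simp: atlas_space_def)

lemma atlas_space_prod: "atlas_space (prod_atlas A A') = atlas_space A \<times> atlas_space A'"
proof (intro equalityI subsetI)
  fix x assume "x \<in> atlas_space A \<times> atlas_space A'"
  then obtain D \<phi> E \<psi> where *: "(D, \<phi>) \<in> A" "(E, \<psi>) \<in> A'" "x \<in> D \<times> E"
    by (auto simp: atlas_space_def)
  then show "x \<in> atlas_space (prod_atlas A A')" by (intro in_atlas_space[OF in_prod_atlas])
qed (auto simp: atlas_space_def prod_atlas_def)

text \<open>The real factor has the identity as its chart, so \<open>snd\<close> is a linear
  function of the product chart. Both S and t are instances.\<close>

lemma smooth_at_snd_prod_real:
  assumes "smooth_atlas_frame A B" "p \<in> atlas_space (prod_atlas A real_atlas)"
  shows "smooth_at (prod_atlas A real_atlas) p snd"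
proof -
  interpret P: smooth_atlas_frame "prod_atlas A real_atlas" "(\<lambda>b. (b, 0)) ` B \<union> Pair 0 ` {1::real}"
    by (rule smooth_atlas_frame_prod[OF assms(1) smooth_atlas_frame_real])
  obtain C \<Phi> where c: "(C, \<Phi>) \<in> prod_atlas A real_atlas" "p \<in> C" using assms(2) by (rule P.in_chartE)
  note op = P.chart_image_open[OF c(1)]
  have "smooth_fun_on (prod_atlas A real_atlas) C (\<lambda>x. snd (\<Phi> x))"
    by (rule P.smooth_fun_on_chart[OF c(1) P.atlas_open_chart[OF c(1)] order_refl])
      (rule smooth_on_linear[OF op bounded_linear_snd smooth_on_ident[OF op]])
  then have "smooth_fun_on (prod_atlas A real_atlas) C snd"
    by (rule P.smooth_fun_on_cong[OF P.atlas_open_chart[OF c(1)], rotated])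
      (use c in \<open>auto simp: prod_atlas_def real_atlas_def\<close>)
  then show ?thesis using c(2) by (rule P.smooth_atI[OF P.atlas_open_chart[OF c(1)]])
qed

subsection \<open>The cotangent bundle\<close>

context smooth_atlas_frame
begin

lemma covector_add:
  "\<xi> \<in> cotangent_space A q \<Longrightarrow> v \<in> tangent_space A q \<Longrightarrow> w \<in> tangent_space A q \<Longrightarrow>
    \<xi> (\<lambda>f. v f + w f) = \<xi> v + \<xi> w"
  by (simp add: cotangent_space_def)

lemma covector_scale:
  "\<xi> \<in> cotangent_space A q \<Longrightarrow> v \<in> tangent_space A q \<Longrightarrow> \<xi> (\<lambda>f. c * v f) = c * \<xi> v"
  by (simp add: cotangent_space_def)

lemma covector_coordinate_linear:
  assumes c: "(D, \<phi>) \<in> A" and q: "q \<in> D" and \<xi>: "\<xi> \<in> cotangent_space A q"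
  shows "linear (\<lambda>u. \<xi> (coordinate_vector A D \<phi> q u))"
proof (rule linearI)
  note T = coordinate_vector_tangent[OF c q]
  show "\<xi> (coordinate_vector A D \<phi> q (u + w)) = \<xi> (coordinate_vector A D \<phi> q u) + \<xi> (coordinate_vector A D \<phi> q w)" for u w
    using covector_add[OF \<xi> T T] coordinate_vector_linear_comb[OF c q, of 1 u 1 w] by simp
  show "\<xi> (coordinate_vector A D \<phi> q (r *\<^sub>R u)) = r *\<^sub>R \<xi> (coordinate_vector A D \<phi> q u)" for r u
    using covector_scale[OF \<xi> T] coordinate_vector_linear_comb[OF c q, of r u 0 u] by simp
qed

text \<open>Resolves the definite description: a vector is determined by its inner products.\<close>

lemma momentum_unique:
  assumes "\<And>u. p \<bullet> u = \<xi> (coordinate_vector A D \<phi> q u)"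
  shows "momentum A D \<phi> q \<xi> = p"
  unfolding momentum_def
proof (rule the_equality)
  fix p' assume "\<forall>u. p' \<bullet> u = \<xi> (coordinate_vector A D \<phi> q u)"
  then have "\<forall>u. u \<bullet> p' = u \<bullet> p" using assms by (simp add: inner_commute)
  then show "p' = p" by (simp add: vector_eq_ldot)
qed (use assms in simp)

text \<open>Existence in the definite description is Riesz representation in finite dimension, with
  the frame sum \<open>?p\<close> as representing vector.\<close>

lemma momentum_inner:
  assumes c: "(D, \<phi>) \<in> A" and q: "q \<in> D" and \<xi>: "\<xi> \<in> cotangent_space A q"
  shows "momentum A D \<phi> q \<xi> \<bullet> u = \<xi> (coordinate_vector A D \<phi> q u)"
proof -
  let ?p = "\<Sum>b\<in>B. \<xi> (coordinate_vector A D \<phi> q b) *\<^sub>R b"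
  have p: "?p \<bullet> u = \<xi> (coordinate_vector A D \<phi> q u)" for u
    using parseval_frame_linear[OF frame covector_coordinate_linear[OF assms], of u]
    by (simp add: inner_sum_left inner_commute[of u] mult.commute)
  then have "momentum A D \<phi> q \<xi> = ?p" by (rule momentum_unique)
  then show ?thesis using p by simp
qed

text \<open>This is p_a dq^a evaluated on \<open>v\<close>; it later makes the Liouville form
  explicit in a chart.\<close>

lemma covector_apply:
  assumes c: "(D, \<phi>) \<in> A" and q: "q \<in> D" and \<xi>: "\<xi> \<in> cotangent_space A q" and v: "v \<in> tangent_space A q"
  shows "\<xi> v = (\<Sum>b\<in>B. v (\<lambda>x. \<phi> x \<bullet> b) * (momentum A D \<phi> q \<xi> \<bullet> b))"
proof -
  have "\<xi> v = \<xi> (coordinate_vector A D \<phi> q (\<Sum>b\<in>B. v (\<lambda>x. \<phi> x \<bullet> b) *\<^sub>R b))"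
    using tangent_representation[OF v c q] by (rule arg_cong)
  also have "\<dots> = momentum A D \<phi> q \<xi> \<bullet> (\<Sum>b\<in>B. v (\<lambda>x. \<phi> x \<bullet> b) *\<^sub>R b)"
    by (rule momentum_inner[OF c q \<xi>, symmetric])
  finally show ?thesis by (simp add: inner_sum_right)
qed

lemma momentum_inj:
  assumes c: "(D, \<phi>) \<in> A" and q: "q \<in> D" and \<xi>: "\<xi> \<in> cotangent_space A q" "\<zeta> \<in> cotangent_space A q"
    and eq: "momentum A D \<phi> q \<xi> = momentum A D \<phi> q \<zeta>"
  shows "\<xi> = \<zeta>"
proof
  fix v
  show "\<xi> v = \<zeta> v"
  proof (cases "v \<in> tangent_space A q")
    case True
    then show ?thesis using covector_apply[OF c q \<xi>(1) True] covector_apply[OF c q \<xi>(2) True] eq by simp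
  next
    case False
    then show ?thesis using \<xi> by (simp add: cotangent_space_def)
  qed
qed

lemma momentum_surj:
  assumes c: "(D, \<phi>) \<in> A" and q: "q \<in> D"
  obtains \<xi> where "\<xi> \<in> cotangent_space A q" "momentum A D \<phi> q \<xi> = p"
proof -
  \<comment> \<open>The covector p_a dq^a, extended by 0 off the tangent space as
    \<open>cotangent_space\<close> demands.\<close>
  define \<xi> where "\<xi> v = (if v \<in> tangent_space A q then \<Sum>b\<in>B. v (\<lambda>x. \<phi> x \<bullet> b) * (p \<bullet> b) else 0)" for v
  have qs: "q \<in> atlas_space A" using c q chart_subset by blast
  have "\<xi> \<in> cotangent_space A q"
    by (simp add: cotangent_space_def \<xi>_def tangent_add[OF qs] tangent_scale[OF qs]
        distrib_right sum.distrib sum_distrib_left mult.assoc)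
  moreover have "p \<bullet> u = \<xi> (coordinate_vector A D \<phi> q u)" for u
  proof -
    have "p \<bullet> (\<Sum>b\<in>B. (u \<bullet> b) *\<^sub>R b) = (\<Sum>b\<in>B. (u \<bullet> b) * (p \<bullet> b))" by (simp add: inner_sum_right)
    then show ?thesis
      by (simp add: \<xi>_def coordinate_vector_tangent[OF c q] coordinate_vector_coordinate[OF c q]
          parseval_frame_sum[OF frame])
  qed
  ultimately show ?thesis using that momentum_unique by blast
qed

text \<open>The transformation law of covector components: the new momentum is linear in the old
  one, with the Jacobian of the old coordinates with respect to the new as coefficients.\<close>

lemma momentum_transition:
  assumes c: "(D, \<phi>) \<in> A" "q \<in> D" and d: "(E, \<psi>) \<in> A" "q \<in> E" and \<xi>: "\<xi> \<in> cotangent_space A q"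
  shows "momentum A E \<psi> q \<xi> = (\<Sum>d\<in>B. (\<Sum>b\<in>B. frechet_derivative (\<lambda>y. \<phi> (inv_into E \<psi> y) \<bullet> b) (at (\<psi> q)) d *
    (momentum A D \<phi> q \<xi> \<bullet> b)) *\<^sub>R d)"
proof -
  have "momentum A E \<psi> q \<xi> \<bullet> u = (\<Sum>b\<in>B. frechet_derivative (\<lambda>y. \<phi> (inv_into E \<psi> y) \<bullet> b) (at (\<psi> q)) u *
    (momentum A D \<phi> q \<xi> \<bullet> b))" for u
    unfolding momentum_inner[OF d \<xi>] covector_apply[OF c \<xi> coordinate_vector_tangent[OF d]]
      coordinate_vector_apply[OF d smooth_at_coordinate[OF c]] ..
  then show ?thesis
    using parseval_frame_sum[OF frame, of "momentum A E \<psi> q \<xi>"] by simp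
qed

lemma smooth_atlas_frame_cotangent:
  "smooth_atlas_frame (cotangent_bundle A) ((\<lambda>b. (b, 0)) ` B \<union> Pair 0 ` B)"
proof
  show "parseval_frame ((\<lambda>b. (b, 0)) ` B \<union> Pair 0 ` B)"
    by (rule parseval_frame_prod[OF frame frame])
  let ?\<Phi> = "\<lambda>D \<phi> (q, \<xi>). (\<phi> q, momentum A D \<phi> q \<xi>)"
  let ?T = "\<lambda>D. Sigma D (cotangent_space A)"
  have inj: "inj_on (?\<Phi> D \<phi>) (?T D)" if c: "(D, \<phi>) \<in> A" for D \<phi>
  proof (rule inj_onI, clarify)
    fix q \<xi> r \<zeta> assume *: "q \<in> D" "\<xi> \<in> cotangent_space A q" "r \<in> D" "\<zeta> \<in> cotangent_space A r"
      "\<phi> q = \<phi> r" "momentum A D \<phi> q \<xi> = momentum A D \<phi> r \<zeta>"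
    then have "q = r" using chart_inj[OF c] by (auto simp: inj_on_def)
    then show "q = r \<and> \<xi> = \<zeta>" using momentum_inj[OF c] * by blast
  qed
  have img: "?\<Phi> D \<phi> ` (?T D \<inter> ?T E) = \<phi> ` (D \<inter> E) \<times> UNIV" if c: "(D, \<phi>) \<in> A" for D \<phi> E
  proof (intro equalityI subsetI)
    fix y assume "y \<in> \<phi> ` (D \<inter> E) \<times> (UNIV :: 'e set)"
    then obtain q p where q: "q \<in> D" "q \<in> E" "y = (\<phi> q, p)" by auto
    obtain \<xi> where "\<xi> \<in> cotangent_space A q" "momentum A D \<phi> q \<xi> = p" using momentum_surj[OF c q(1)] .
    then show "y \<in> ?\<Phi> D \<phi> ` (?T D \<inter> ?T E)" using q by (intro image_eqI[of _ _ "(q, \<xi>)"]) auto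
  qed auto
  have op: "open (?\<Phi> D \<phi> ` (?T D \<inter> ?T E))" if c: "(D, \<phi>) \<in> A" and d: "(E, \<psi>) \<in> A" for D \<phi> E \<psi>
    unfolding img[OF c] by (intro open_Times transition_domain_open[OF c d] open_UNIV)
  have trans: "smooth_on (?\<Phi> D \<phi> ` (?T D \<inter> ?T E)) (?\<Phi> E \<psi> \<circ> inv_into (?T D) (?\<Phi> D \<phi>))"
    if c: "(D, \<phi>) \<in> A" and d: "(E, \<psi>) \<in> A" for D \<phi> E \<psi>
  proof -
    let ?S = "?\<Phi> D \<phi> ` (?T D \<inter> ?T E)"
    note op = op[OF c d]
    let ?t = "\<lambda>y::'e \<times> 'e. \<psi> (inv_into D \<phi> (fst y))"
    \<comment> \<open>The Jacobian lives over the target chart, so it is composed with the base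
      transition \<open>?t\<close> to become a function on \<open>?S\<close>.\<close>
    let ?J = "\<lambda>b d y. frechet_derivative (\<lambda>y. \<phi> (inv_into E \<psi> y) \<bullet> b) (at y) d"
    have fs: "smooth_on ?S fst" "smooth_on ?S snd"
      by (rule smooth_on_linear[OF op bounded_linear_fst smooth_on_ident[OF op]],
          rule smooth_on_linear[OF op bounded_linear_snd smooth_on_ident[OF op]])
    have t: "smooth_on ?S ?t"
      by (rule smooth_on_compose[OF frame op fs(1) transition_smooth[OF c d]]) (auto simp: img[OF c])
    have opE: "open (\<psi> ` (E \<inter> D))" by (rule transition_domain_open[OF d c])
    have tS: "?t ` ?S \<subseteq> \<psi> ` (E \<inter> D)" using inv_chart[OF c] by auto
    have J: "smooth_on ?S (\<lambda>y. ?J b d (?t y))" for b d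
      by (rule smooth_on_compose[OF frame op t smooth_on_derivative tS],
          rule smooth_on_inner[OF opE transition_smooth[OF \<open>(E, \<psi>) \<in> A\<close> c] smooth_on_const[OF opE]])
    have "smooth_on ?S (\<lambda>y. (?t y, \<Sum>d\<in>B. (\<Sum>b\<in>B. ?J b d (?t y) * (snd y \<bullet> b)) *\<^sub>R d))"
      by (intro smooth_on_Pair[OF op t] smooth_on_sum[OF op] smooth_on_scaleR[OF op] smooth_on_mult[OF op]
          smooth_on_inner[OF op] smooth_on_const[OF op] fs J)
    then show ?thesis
    proof (rule smooth_on_cong[OF op, rotated])
      fix y assume "y \<in> ?S"
      then obtain q \<xi> where q: "q \<in> D" "q \<in> E" "\<xi> \<in> cotangent_space A q" "?\<Phi> D \<phi> (q, \<xi>) = y" by auto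
      have "inv_into (?T D) (?\<Phi> D \<phi>) y = (q, \<xi>)"
        by (rule inv_into_eq[OF inj[OF c] _ q(4)]) (use q in auto)
      then show "(?t y, \<Sum>d\<in>B. (\<Sum>b\<in>B. ?J b d (?t y) * (snd y \<bullet> b)) *\<^sub>R d) =
          (?\<Phi> E \<psi> \<circ> inv_into (?T D) (?\<Phi> D \<phi>)) y"
        using q(4) momentum_transition[OF c q(1) d q(2,3)] by (auto simp: inv_chart[OF c q(1)])
    qed
  qed
  show "smooth_atlas (cotangent_bundle A)"
    unfolding smooth_atlas_def
  proof (intro conjI ballI)
    fix e assume "e \<in> cotangent_bundle A"
    then obtain D \<phi> where e: "e = (?T D, ?\<Phi> D \<phi>)" "(D, \<phi>) \<in> A"
      unfolding cotangent_bundle_def by blast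
    show "case e of (D, \<phi>) \<Rightarrow> inj_on \<phi> D \<and> open (\<phi> ` D)"
      unfolding e(1) prod.case using inj[OF e(2)] op[OF e(2) e(2)] by simp
    show "case e of (D, \<phi>) \<Rightarrow> \<forall>(E, \<psi>)\<in>cotangent_bundle A.
        open (\<phi> ` (D \<inter> E)) \<and> smooth_on (\<phi> ` (D \<inter> E)) (\<psi> \<circ> inv_into D \<phi>)"
      unfolding e(1) prod.case
    proof
      fix e' assume "e' \<in> cotangent_bundle A"
      then obtain D' \<phi>' where e': "e' = (?T D', ?\<Phi> D' \<phi>')" "(D', \<phi>') \<in> A"
        unfolding cotangent_bundle_def by blast
      show "case e' of (X, g) \<Rightarrow> open (?\<Phi> D \<phi> ` (?T D \<inter> X)) \<and>
          smooth_on (?\<Phi> D \<phi> ` (?T D \<inter> X)) (g \<circ> inv_into (?T D) (?\<Phi> D \<phi>))"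
        unfolding e'(1) prod.case using op[OF e(2) e'(2)] trans[OF e(2) e'(2)] by blast
    qed
  qed
qed

lemma chart_projection_cotangent:
  "chart_projection (cotangent_bundle A) ((\<lambda>b. (b, 0)) ` B \<union> Pair 0 ` B) A B fst fst"
proof (intro chart_projection.intro chart_projection_axioms.intro smooth_atlas_frame_cotangent
    smooth_atlas_frame_axioms bounded_linear_fst)
  fix C \<Phi> assume "(C, \<Phi>) \<in> cotangent_bundle A"
  then obtain D \<phi> where "C = Sigma D (cotangent_space A)" "\<Phi> = (\<lambda>(q, \<xi>). (\<phi> q, momentum A D \<phi> q \<xi>))" "(D, \<phi>) \<in> A"
    unfolding cotangent_bundle_def by blast
  then show "\<exists>D \<phi>. (D, \<phi>) \<in> A \<and> fst ` C \<subseteq> D \<and> (\<forall>x\<in>C. \<phi> (fst x) = fst (\<Phi> x))"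
    by (intro exI[of _ D] exI[of _ \<phi>]) auto
qed

lemma atlas_space_cotangent: "atlas_space (cotangent_bundle A) = Sigma (atlas_space A) (cotangent_space A)"
proof (intro equalityI subsetI)
  fix x assume x: "x \<in> Sigma (atlas_space A) (cotangent_space A)"
  then obtain D \<phi> where c: "(D, \<phi>) \<in> A" "fst x \<in> D" by (auto simp: atlas_space_def)
  have "x \<in> Sigma D (cotangent_space A)" using c x by auto
  then show "x \<in> atlas_space (cotangent_bundle A)" by (rule in_atlas_space[OF in_cotangent_bundle[OF c(1)]])
qed (auto simp: atlas_space_def cotangent_bundle_def)

end

subsection \<open>The extended contact form\<close>

text \<open>Linearity holds because pushforwards are linear and points of T*Q carry linear
  covectors. Smoothness is local, so it is checked on the chart of the extended phase space lying
  over a chart of \<open>Q\<close>.\<close>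

lemma smooth_one_form_extended_form:
  fixes Q :: "('q, 'e::real_inner) atlas"
  assumes Q: "smooth_atlas_frame Q B"
    and h: "smooth_fun_on (extended_phase_space Q) (atlas_space (extended_phase_space Q)) h"
  shows "\<exists>B'. smooth_one_form (extended_phase_space Q) B' (extended_form Q h)"
proof -
  interpret Q: smooth_atlas_frame Q B by fact
  define M0 where "M0 = cotangent_bundle Q"
  define M1 where "M1 = contact_phase_space Q"
  define M where "M = extended_phase_space Q"
  define B0 where "B0 = (\<lambda>b::'e. (b, 0::'e)) ` B \<union> Pair 0 ` B"
  define B1 where "B1 = (\<lambda>b::'e \<times> 'e. (b, 0::real)) ` B0 \<union> Pair 0 ` {1}"
  define B2 where "B2 = (\<lambda>b::('e \<times> 'e) \<times> real. (b, 0::real)) ` B1 \<union> Pair 0 ` {1}"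
  have M1: "M1 = prod_atlas M0 real_atlas" and M: "M = prod_atlas M1 real_atlas"
    by (simp_all add: M0_def M1_def M_def contact_phase_space_def extended_phase_space_def)
  interpret p0: chart_projection M0 B0 Q B fst fst
    unfolding M0_def B0_def by (rule Q.chart_projection_cotangent)
  interpret p1: chart_projection M1 B1 M0 B0 fst fst
    unfolding M1 B1_def by (rule chart_projection_fst[OF p0.M.smooth_atlas_frame_axioms smooth_atlas_frame_real])
  interpret p2: chart_projection M B2 M1 B1 fst fst
    unfolding M B2_def by (rule chart_projection_fst[OF p1.M.smooth_atlas_frame_axioms smooth_atlas_frame_real])
  have space: "m \<in> atlas_space M \<longleftrightarrow> fst m \<in> atlas_space M1"
    "m' \<in> atlas_space M1 \<longleftrightarrow> fst m' \<in> atlas_space M0"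
    "m'' \<in> atlas_space M0 \<longleftrightarrow> fst m'' \<in> atlas_space Q \<and> snd m'' \<in> cotangent_space Q (fst m'')"
    for m m' m''
    unfolding M M1 atlas_space_prod
    by (simp_all add: mem_Times_iff M0_def Q.atlas_space_cotangent mem_Sigma_iff[of "fst m''" "snd m''", simplified]
        atlas_space_def[of "{(UNIV, id)}"] real_atlas_def)
  \<comment> \<open>Successive pushforwards to the contact phase space, to T*Q and to Q: dS is read
    off \<open>?v1\<close>, and the covector at the point is applied to \<open>?v3\<close>.\<close>
  let ?v1 = "\<lambda>m v. pushforward M1 fst m v"
  let ?v2 = "\<lambda>m v. pushforward M0 fst (fst m) (?v1 m v)"
  let ?v3 = "\<lambda>m v. pushforward Q fst (fst (fst m)) (?v2 m v)"
  have form: "extended_form Q h m v = ?v1 m v snd - snd (fst (fst m)) (?v3 m v) + h m * v snd" for m v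
    by (simp add: extended_form_def pullback_def contact_form_def differential_def liouville_form_def M0_def M1_def)
  have v3: "?v3 m v \<in> tangent_space Q (fst (fst (fst m)))" if "v \<in> tangent_space M m" for m v
    by (intro p0.pushforward_tangent p1.pushforward_tangent p2.pushforward_tangent that)
  have snd0: "smooth_at M m snd" if "m \<in> atlas_space M" for m
    using smooth_at_snd_prod_real[OF p1.M.smooth_atlas_frame_axioms] that unfolding M by blast
  have snd1: "smooth_at M1 m snd" if "m \<in> atlas_space M1" for m
    using smooth_at_snd_prod_real[OF p0.M.smooth_atlas_frame_axioms] that unfolding M1 by blast
  have v1_snd: "?v1 m v snd = v (\<lambda>x. snd (fst x))" if "m \<in> atlas_space M" for m v
    using p2.pushforward_apply snd1 that space by blast
  have "smooth_one_form M B2 (extended_form Q h)"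
  proof
    fix m v w and c :: real
    assume v: "v \<in> tangent_space M m"
    have \<xi>: "snd (fst (fst m)) \<in> cotangent_space Q (fst (fst (fst m)))"
      using p2.M.tangent_space_point[OF v] space by blast
    show "extended_form Q h m (\<lambda>f. c * v f) = c * extended_form Q h m v"
      unfolding form pushforward_scale Q.covector_scale[OF \<xi> v3[OF v]] by (simp add: algebra_simps)
    assume w: "w \<in> tangent_space M m"
    show "extended_form Q h m (\<lambda>f. v f + w f) = extended_form Q h m v + extended_form Q h m w"
      unfolding form pushforward_add Q.covector_add[OF \<xi> v3[OF v] v3[OF w]] by (simp add: algebra_simps)
  next
    fix X assume X: "X \<in> vector_fields M"
    show "smooth_fun_on M (atlas_space M) (\<lambda>m. extended_form Q h m (X m))"
    proof (rule p2.M.smooth_fun_on_locally)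
      fix m assume m: "m \<in> atlas_space M"
      then have "fst (fst (fst m)) \<in> atlas_space Q" using space by blast
      then obtain D \<phi> where c: "(D, \<phi>) \<in> Q" and q: "fst (fst (fst m)) \<in> D" by (rule Q.in_chartE)
      define C where "C = (Sigma D (cotangent_space Q) \<times> (UNIV :: real set)) \<times> (UNIV :: real set)"
      define \<Phi> where "\<Phi> = map_prod (map_prod (\<lambda>(q, \<xi>). (\<phi> q, momentum Q D \<phi> q \<xi>)) (id :: real \<Rightarrow> real)) (id :: real \<Rightarrow> real)"
      have C: "(C, \<Phi>) \<in> M"
        unfolding C_def \<Phi>_def M M1 M0_def
        by (intro in_prod_atlas in_cotangent_bundle c) (simp_all add: real_atlas_def)
      have mC: "m \<in> C"
        using m q space(1)[of m] space(2)[of "fst m"] space(3)[of "fst (fst m)"]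
        unfolding C_def mem_Times_iff by (cases "fst (fst m)") auto
      note opC = p2.M.atlas_open_chart[OF C] and op\<Phi> = p2.M.chart_image_open[OF C]
      have inC: "fst (fst (fst x)) \<in> D" "snd (fst (fst x)) \<in> cotangent_space Q (fst (fst (fst x)))" if "x \<in> C" for x
        using that unfolding C_def by auto
      have CM: "C \<subseteq> atlas_space M" by (rule p2.M.chart_subset[OF C])
      have q_smooth: "smooth_fun_on M C (\<lambda>x. \<phi> (fst (fst (fst x))) \<bullet> b)"
        and p_smooth: "smooth_fun_on M C (\<lambda>x. momentum Q D \<phi> (fst (fst (fst x))) (snd (fst (fst x))) \<bullet> b)" for b
      proof -
        note lin = bounded_linear_inner_left_comp bounded_linear_compose[OF bounded_linear_fst] bounded_linear_compose[OF bounded_linear_snd]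
        have "smooth_on (\<Phi> ` C) (\<lambda>y. fst (fst (fst y)) \<bullet> b)" "smooth_on (\<Phi> ` C) (\<lambda>y. snd (fst (fst y)) \<bullet> b)"
          by (rule smooth_on_linear[OF op\<Phi> _ smooth_on_ident[OF op\<Phi>]],
              intro lin bounded_linear_fst bounded_linear_snd)+
        from this[THEN p2.M.smooth_fun_on_chart[OF C opC order_refl]]
        show "smooth_fun_on M C (\<lambda>x. \<phi> (fst (fst (fst x))) \<bullet> b)"
          "smooth_fun_on M C (\<lambda>x. momentum Q D \<phi> (fst (fst (fst x))) (snd (fst (fst x))) \<bullet> b)"
          by (simp_all add: \<Phi>_def case_prod_beta)
      qed
      \<comment> \<open>A pushforward returns the dummy value 0 on functions that are not smooth, so
        the coordinate function has to be lifted and checked at each of the three stages.\<close>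
      have v3_apply: "?v3 x v (\<lambda>y. \<phi> y \<bullet> b) = v (\<lambda>x. \<phi> (fst (fst (fst x))) \<bullet> b)" if x: "x \<in> C" for x v b
      proof -
        have s: "x \<in> atlas_space M" "fst x \<in> atlas_space M1" "fst (fst x) \<in> atlas_space M0"
          using x CM space by blast+
        note s0 = Q.smooth_at_coordinate[OF c inC(1)[OF x], of b]
        note s1 = p0.smooth_at_compose[OF s(3) s0]
        note s2 = p1.smooth_at_compose[OF s(2) s1]
        show ?thesis by (simp add: p0.pushforward_apply[OF s0] p1.pushforward_apply[OF s1] p2.pushforward_apply[OF s2])
      qed
      \<comment> \<open>The local formula dS - p_a dq^a + h dt, in which every constituent is a
        smooth function or a vector field applied to one.\<close>
      have eq: "X x (\<lambda>x. snd (fst x)) -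
          (\<Sum>b\<in>B. X x (\<lambda>x. \<phi> (fst (fst (fst x))) \<bullet> b) *
            (momentum Q D \<phi> (fst (fst (fst x))) (snd (fst (fst x))) \<bullet> b)) + h x * X x snd =
          extended_form Q h x (X x)" if x: "x \<in> C" for x
        unfolding form v1_snd[OF subsetD[OF CM x]]
          Q.covector_apply[OF c inC[OF x] v3[OF p2.M.vf_tangent[OF X subsetD[OF CM x]]]] v3_apply[OF x] ..
      have snd_smooth: "smooth_fun_on M (atlas_space M) snd" "smooth_fun_on M (atlas_space M) (\<lambda>x. snd (fst x))"
        using snd0 p2.smooth_at_compose[OF _ snd1] space(1)
        by (auto intro!: p2.M.smooth_fun_on_locally simp: smooth_at_def[symmetric])
      have "smooth_fun_on M C (\<lambda>x. X x (\<lambda>x. snd (fst x)) -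
          (\<Sum>b\<in>B. X x (\<lambda>x. \<phi> (fst (fst (fst x))) \<bullet> b) *
            (momentum Q D \<phi> (fst (fst (fst x))) (snd (fst (fst x))) \<bullet> b)) + h x * X x snd)"
        using h[folded M_def]
        by (intro p2.M.smooth_fun_on_add[OF opC] p2.M.smooth_fun_on_diff[OF opC] p2.M.smooth_fun_on_sum[OF opC]
            p2.M.smooth_fun_on_mult[OF opC] p2.M.vf_smooth[OF X opC] q_smooth p_smooth
            p2.M.smooth_fun_on_subset[OF _ CM] snd_smooth)
      then have "smooth_fun_on M C (\<lambda>m. extended_form Q h m (X m))"
        by (rule p2.M.smooth_fun_on_cong[OF opC eq, rotated])
      then show "\<exists>V. atlas_open M V \<and> m \<in> V \<and> smooth_fun_on M V (\<lambda>m. extended_form Q h m (X m))"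
        using opC mC by blast
    qed
  qed
  then show ?thesis unfolding M_def by blast
qed

theorem proposition5:
  fixes Q :: "('q, 'e::real_inner) atlas"
    and h :: "(('q \<times> 'q covector) \<times> real) \<times> real \<Rightarrow> real"
  assumes "smooth_manifold Q"
    and "smooth_fun_on (extended_phase_space Q) (atlas_space (extended_phase_space Q)) h"
  shows "real_lie_algebra (generalized_noether_symmetries Q h)
           vf_add vf_zero vf_scale (lie_bracket (extended_phase_space Q))"
proof -
  \<comment> \<open>The finite spanning set in \<open>smooth_manifold\<close> provides the frame of
    the model space.\<close>
  obtain B :: "'e set" where "parseval_frame B"
    using assms(1) parseval_frame_exists unfolding smooth_manifold_def by metis
  then have "smooth_atlas_frame Q B"
    using assms(1) by (simp add: smooth_atlas_frame_def smooth_manifold_def)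
  then obtain B' where "smooth_one_form (extended_phase_space Q) B' (extended_form Q h)"
    using smooth_one_form_extended_form assms(2) by blast
  then interpret smooth_one_form "extended_phase_space Q" B' "extended_form Q h" .
  have "generalized_noether_symmetries Q h = conformal_symmetries"
    by (simp add: generalized_noether_symmetries_def conformal_symmetries_def Let_def)
  then show ?thesis using conformal_symmetries_lie_algebra by simp
qed

end
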